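(* Let $G$ be a $2$-edge-connected graph with vertex set $V$, let $\emptyset\subsetneq S\subsetneq V$ be such that $\delta(S)$ is an inclusion-wise minimal cut, and let $e_1\in E(G[S])$, $e_2\in E(G[V\setminus S])$. For $W\in\{S,V\setminus S\}$ and a bridge $f\notin\{e_1,e_2\}$ of $G[W]$, let $\delta(W,f)\subseteq\delta(S)$ be the set of edges of $\delta(S)$ having an endpoint in the connected component of $G[W]-f$ that contains neither $e_1$ nor $e_2$. Then the connectivity cut inequality $$2x_{e_1}-x(\delta(S))+2x_{e_2}\le 2$$ defines a facet of $\mathrm{TECSP}(G)$ if and only if one of the following holds: (i) ($e_1$ is a bridge of $G[S]$ or $e_2$ is a bridge of $G[V\setminus S]$) and $|\delta(S)|=2$; (ii) $e_1$ is not a bridge of $G[S]$, $e_2$ is not a bridge of $G[V\setminus S]$, and for every $W\in\{S,V\setminus S\}$ and every bridge $f$ of $G[W]$ we have $|\delta(W,f)|=1$.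
   Context: All graphs are finite, simple and undirected. For $\emptyset\subsetneq S\subsetneq V(G)$, $\delta(S)$ is the set of edges with exactly one endpoint in $S$ (a cut); $G[S]$ is the induced subgraph on $S$; $G[W]-f$ is $G[W]$ with edge $f$ deleted. An edge is a bridge of a graph if its removal increases the number of connected components. A graph is $2$-edge-connected if it is connected and has no bridges; the empty graph and a single vertex are $2$-edge-connected. For $F\subseteq E(G)$, $x(F)=\sum_{f\in F}x_f$. $\chi^H\in\{0,1\}^{E(G)}$ is the incidence vector of $E(H)$, and $\mathrm{TECSP}(G)=\mathrm{conv}\{\chi^H : H\subseteq G\text{ is }2\text{-edge-connected}\}\subseteq\mathbb{R}^{E(G)}$. A facet is a face of dimension $\dim(\mathrm{TECSP}(G))-1$. *)

theory Defs
  imports "HOL-Analysis.Analysis"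
begin

text \<open>A finite simple graph G: vertex set = UNIV of a finite type 'v, edge set = UNIV of a
finite type 'e, with endpoint map ends (each edge is a 2-set of vertices, ends injective).
Subgraphs are pairs (W, F) with W a vertex set and F an edge set with ends inside W.\<close>

definition adj :: "('e \<Rightarrow> 'v set) \<Rightarrow> 'e set \<Rightarrow> ('v \<times> 'v) set" where
  "adj ends F = {(u, v). \<exists>e\<in>F. ends e = {u, v}}"

definition is_subgraph :: "('e \<Rightarrow> 'v set) \<Rightarrow> 'v set \<Rightarrow> 'e set \<Rightarrow> bool" where
  "is_subgraph ends W F \<longleftrightarrow> (\<forall>e\<in>F. ends e \<subseteq> W)"

text \<open>Connected components (as vertex sets) of the graph (W, F).\<close>
definition comps :: "('e \<Rightarrow> 'v set) \<Rightarrow> 'v set \<Rightarrow> 'e set \<Rightarrow> 'v set set" where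
  "comps ends W F = (\<lambda>v. {u \<in> W. (v, u) \<in> (adj ends F)\<^sup>*}) ` W"

definition g_connected :: "('e \<Rightarrow> 'v set) \<Rightarrow> 'v set \<Rightarrow> 'e set \<Rightarrow> bool" where
  "g_connected ends W F \<longleftrightarrow> (\<forall>u\<in>W. \<forall>v\<in>W. (u, v) \<in> (adj ends F)\<^sup>*)"

text \<open>e is a bridge of (W, F): removing it increases the number of connected components.\<close>
definition is_bridge :: "('e \<Rightarrow> 'v set) \<Rightarrow> 'v set \<Rightarrow> 'e set \<Rightarrow> 'e \<Rightarrow> bool" where
  "is_bridge ends W F e \<longleftrightarrow> e \<in> F \<and> card (comps ends W F) < card (comps ends W (F - {e}))"

definition two_edge_connected :: "('e \<Rightarrow> 'v set) \<Rightarrow> 'v set \<Rightarrow> 'e set \<Rightarrow> bool" where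
  "two_edge_connected ends W F \<longleftrightarrow> g_connected ends W F \<and> (\<forall>e\<in>F. \<not> is_bridge ends W F e)"

text \<open>Edge set of the induced subgraph G[S].\<close>
definition induced_edges :: "('e \<Rightarrow> 'v set) \<Rightarrow> 'v set \<Rightarrow> 'e set" where
  "induced_edges ends S = {e. ends e \<subseteq> S}"

text \<open>The cut delta(S).\<close>
definition cut :: "('e \<Rightarrow> 'v set) \<Rightarrow> 'v set \<Rightarrow> 'e set" where
  "cut ends S = {e. card (ends e \<inter> S) = 1}"

definition min_cut :: "('e \<Rightarrow> 'v set) \<Rightarrow> 'v set \<Rightarrow> bool" where
  "min_cut ends S \<longleftrightarrow> {} \<noteq> S \<and> S \<noteq> UNIV \<and>
     (\<forall>S'. {} \<noteq> S' \<and> S' \<noteq> UNIV \<and> cut ends S' \<subseteq> cut ends S \<longrightarrow> cut ends S' = cut ends S)"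

definition incidence :: "'e set \<Rightarrow> real ^ 'e::finite" where
  "incidence F = (\<chi> e. if e \<in> F then 1 else 0)"

definition TECSP :: "('e::finite \<Rightarrow> 'v set) \<Rightarrow> (real ^ 'e) set" where
  "TECSP ends = convex hull {incidence F | W F. is_subgraph ends W F \<and> two_edge_connected ends W F}"

definition xsum :: "real ^ 'e::finite \<Rightarrow> 'e set \<Rightarrow> real" where
  "xsum x F = (\<Sum>e\<in>F. x $ e)"

text \<open>The inequality a.x <= b defines a facet of P: it is valid for P and the set of points
of P where it is tight is a facet of P.\<close>
definition defines_facet :: "(real ^ 'e::finite \<Rightarrow> real) \<Rightarrow> real \<Rightarrow> (real ^ 'e) set \<Rightarrow> bool" where
  "defines_facet lhs b P \<longleftrightarrow> (\<forall>x\<in>P. lhs x \<le> b) \<and> {x \<in> P. lhs x = b} facet_of P"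

text \<open>delta(W,f): edges of delta(S) having an endpoint in the connected component of
G[W]-f that contains neither e1 nor e2 (a component contains an edge if it contains both ends).\<close>
definition delta_Wf :: "('e \<Rightarrow> 'v set) \<Rightarrow> 'v set \<Rightarrow> 'e \<Rightarrow> 'e \<Rightarrow> 'v set \<Rightarrow> 'e \<Rightarrow> 'e set" where
  "delta_Wf ends S e1 e2 W f = {e \<in> cut ends S. \<exists>C \<in> comps ends W (induced_edges ends W - {f}).
       \<not> ends e1 \<subseteq> C \<and> \<not> ends e2 \<subseteq> C \<and> ends e \<inter> C \<noteq> {}}"

end

(*
  Write d_F(X) for the edges of an edge set F leaving X. An edge set is the edge set of a
  2-edge-connected subgraph iff no d_F(X) is a single edge and d_F(X) = {} only if all of F lies on
  one side of X; so the argument runs on cuts and their symmetric differences, without paths.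

  The face misses 0, hence it is a facet iff the incidence vectors of the tight 2-edge-connected
  subgraphs span those of all of them, i.e. iff every weight w that vanishes on the tight ones vanishes
  on all of them.

  Necessity: let f be a bridge of G[S] splitting off Y. A tight subgraph contains exactly one edge of
  cut(S) at Y if it contains f, and none otherwise; G itself does so only if there is exactly one.

  Sufficiency: call two edges in series if they are equal or form a 2-edge cut; 2-edge-connected
  subgraphs are unions of series classes. If w vanishes on all 2-edge-connected H with R <= H <= F, then
  w vanishes on every series class of F whose deletion leaves R in one component (induction on
  the size of that component). In case (i) this applies to R = {e2}. In case (ii), let U be the
  2-edge-connected part containing g and h of G minus the other edges of cut(S), for g, h in cut(S);
  all series classes of U have weight 0, and every series class of G is recovered from
  classes of suitable U's.
*)
theory Submission
  imports Defs
begin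

section \<open>Cuts, series classes and 2-edge-connected edge sets\<close>

text \<open>A subgraph through both \<open>e1\<close> and \<open>e2\<close> is tight only with
  exactly two edges of the cut, so for a larger cut \<open>G\<close> itself is not tight and weights
  can only be tested inside the graphs \<open>U\<close>. Two obstacles shape case (ii). Inside
  \<open>U\<close>, a series class is removable only if \<open>e1\<close> and \<open>e2\<close> stay
  in one component, but a class inside the 2-edge-connected part \<open>K\<close> of
  \<open>G[S]\<close> around \<open>e1\<close> may separate them. Such a class is reached through
  \<open>K\<close>: the series classes of \<open>K\<close> have weight 0, they are unions of classes
  of \<open>U\<close>, and each contains at most one separating class. The second obstacle is that
  deleting cut edges merges series classes, so a class of \<open>U\<close> need not be one of
  \<open>G\<close>. The pair \<open>g\<close>, \<open>h\<close> is therefore adapted to the edge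
  \<open>d\<close> in question, so that every edge in series with \<open>d\<close> in
  \<open>U\<close> is so in \<open>G\<close>. For the cut edges themselves merging is unavoidable:
  the class of \<open>g\<close> in \<open>U\<close> gives only the sum of the weights of two classes
  of \<open>G\<close>, and a third cut edge is used to separate them. A cut of two edges is the case
  \<open>U\<close> = \<open>G\<close>.\<close>

locale multigraph =
  fixes ends :: "'e::finite \<Rightarrow> 'v::finite set"
  assumes card_ends: "card (ends e) = 2"
begin

abbreviation \<delta> :: "'v set \<Rightarrow> 'e set" where
  "\<delta> \<equiv> cut ends"

text \<open>An arbitrary fixed orientation. It turns membership in a cut into a propositional
  statement about two vertices, so that identities between cuts become propositional.\<close>

definition src :: "'e \<Rightarrow> 'v" where
  "src e = (SOME u. u \<in> ends e)"

definition tgt :: "'e \<Rightarrow> 'v" where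
  "tgt e = (SOME v. v \<in> ends e \<and> v \<noteq> src e)"

lemma ends_eq: "ends e = {src e, tgt e}" and src_neq_tgt: "src e \<noteq> tgt e"
proof -
  obtain u v where uv: "ends e = {u, v}" "u \<noteq> v"
    using card_ends[of e] by (meson card_2_iff)
  have s: "src e \<in> ends e"
    unfolding src_def using uv by (metis insertI1 someI)
  then have "\<exists>v. v \<in> ends e \<and> v \<noteq> src e"
    using uv by blast
  then have t: "tgt e \<in> ends e \<and> tgt e \<noteq> src e"
    unfolding tgt_def by (rule someI_ex)
  show "ends e = {src e, tgt e}" "src e \<noteq> tgt e"
    using s t uv by auto
qed

lemma in_cut: "e \<in> \<delta> X \<longleftrightarrow> (src e \<in> X) \<noteq> (tgt e \<in> X)"
proof -
  have "ends e \<inter> X = (if src e \<in> X then {src e} else {}) \<union> (if tgt e \<in> X then {tgt e} else {})"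
    using ends_eq[of e] by auto
  then show ?thesis
    using src_neq_tgt[of e] by (auto simp: cut_def)
qed

lemma ends_subset: "ends e \<subseteq> X \<longleftrightarrow> src e \<in> X \<and> tgt e \<in> X"
  using ends_eq[of e] by auto

lemma ends_disjoint: "ends e \<inter> X = {} \<longleftrightarrow> src e \<notin> X \<and> tgt e \<notin> X"
  using ends_eq[of e] by auto

lemma in_induced: "e \<in> induced_edges ends X \<longleftrightarrow> src e \<in> X \<and> tgt e \<in> X"
  by (simp add: induced_edges_def ends_subset)

lemma cut_Compl: "\<delta> (- X) = \<delta> X"
  by (auto simp: in_cut)

lemma cut_sym_diff:
  "F \<inter> \<delta> (X - Y \<union> (Y - X)) = (F \<inter> \<delta> X - F \<inter> \<delta> Y) \<union> (F \<inter> \<delta> Y - F \<inter> \<delta> X)"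
  by (auto simp: in_cut)

lemma not_closedD: "F \<inter> \<delta> X \<noteq> {} \<Longrightarrow> \<exists>e\<in>F. (src e \<in> X) \<noteq> (tgt e \<in> X)"
  by (auto simp: in_cut)

lemma closedD: "F \<inter> \<delta> X = {} \<Longrightarrow> e \<in> F \<Longrightarrow> src e \<in> X \<longleftrightarrow> tgt e \<in> X"
  using in_cut[of e X] by blast

definition bridges :: "'e set \<Rightarrow> 'e set" where
  "bridges F = {f. \<exists>X. F \<inter> \<delta> X = {f}}"

text \<open>No vertex set occurs, because an incidence vector sees only the edges. Connectivity is
  required of the edges alone, and the empty edge set qualifies.\<close>

definition tec :: "'e set \<Rightarrow> bool" where
  "tec F \<longleftrightarrow> bridges F = {} \<and>
     (\<forall>X. F \<inter> \<delta> X = {} \<longrightarrow> (\<forall>e\<in>F. ends e \<subseteq> X) \<or> (\<forall>e\<in>F. ends e \<inter> X = {}))"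

definition series :: "'e set \<Rightarrow> 'e \<Rightarrow> 'e \<Rightarrow> bool" where
  "series F f g \<longleftrightarrow> f = g \<or> (\<exists>X. F \<inter> \<delta> X = {f, g})"

definition cls :: "'e set \<Rightarrow> 'e \<Rightarrow> 'e set" where
  "cls F f = {g. series F f g}"

text \<open>\<open>reach F r\<close> is the vertex set of the component of \<open>F\<close> containing the edge \<open>r\<close>, and
  \<open>block F r\<close> is its edge set.\<close>

definition reach :: "'e set \<Rightarrow> 'e \<Rightarrow> 'v set" where
  "reach F r = \<Inter>{X. F \<inter> \<delta> X = {} \<and> ends r \<subseteq> X}"

definition block :: "'e set \<Rightarrow> 'e \<Rightarrow> 'e set" where
  "block F r = {e \<in> F. ends e \<subseteq> reach F r}"

text \<open>For a non-bridge \<open>r\<close> of \<open>F\<close> this is the 2-edge-connected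
  component of \<open>r\<close>: the largest \<open>tec\<close> subset of \<open>F\<close> through
  \<open>r\<close>, by \<open>core_tec\<close> and \<open>tec_subset_core\<close>.\<close>

definition core :: "'e set \<Rightarrow> 'e \<Rightarrow> 'e set" where
  "core F r = block (F - bridges F) r"

lemma cut_not_single: "bridges F = {} \<Longrightarrow> F \<inter> \<delta> X \<noteq> {f}"
  unfolding bridges_def by blast

lemma bridges_subset: "bridges F \<subseteq> F"
  unfolding bridges_def by blast

lemma tec_bridges: "tec F \<Longrightarrow> bridges F = {}"
  by (simp add: tec_def)

lemma tec_not_separated:
  assumes "tec F" "F \<inter> \<delta> X = {}" "e \<in> F" "f \<in> F" "src e \<in> X \<or> tgt e \<in> X"
  shows "src f \<in> X \<and> tgt f \<in> X"
  using assms unfolding tec_def ends_subset ends_disjoint by blast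

lemma bridgeless_subset_bridges:
  assumes "bridges H = {}" "H \<subseteq> F"
  shows "H \<inter> bridges F = {}"
proof (rule ccontr)
  assume "H \<inter> bridges F \<noteq> {}"
  then obtain b X where "b \<in> H" "F \<inter> \<delta> X = {b}"
    unfolding bridges_def by blast
  then have "H \<inter> \<delta> X = {b}"
    using assms(2) by blast
  then show False
    using cut_not_single[OF assms(1)] by blast
qed

text \<open>The symmetric difference of \<open>X\<close> with a one-edge cut set \<open>Y\<close>
  removes that edge from the cut. If \<open>Y\<close> does not separate \<open>p\<close> from
  \<open>q\<close>, it does not change whether the set separates them.\<close>

lemma parity_bridges:
  assumes "\<forall>d\<in>D. \<exists>Y. F \<inter> \<delta> Y = {d} \<and> (p \<in> Y \<longleftrightarrow> q \<in> Y)"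
  shows "\<exists>X'. F \<inter> \<delta> X' = F \<inter> \<delta> X - D \<and> ((p \<in> X' \<longleftrightarrow> q \<in> X') \<longleftrightarrow> (p \<in> X \<longleftrightarrow> q \<in> X))"
proof (induction "card (F \<inter> \<delta> X \<inter> D)" arbitrary: X rule: less_induct)
  case less
  show ?case
  proof (cases "F \<inter> \<delta> X \<inter> D = {}")
    case True
    then show ?thesis by blast
  next
    case False
    then obtain d where d: "d \<in> F \<inter> \<delta> X \<inter> D" by blast
    then obtain Y where Y: "F \<inter> \<delta> Y = {d}" "p \<in> Y \<longleftrightarrow> q \<in> Y"
      using assms by blast
    define X1 where "X1 = X - Y \<union> (Y - X)"
    have X1: "F \<inter> \<delta> X1 = F \<inter> \<delta> X - {d}"
      unfolding X1_def cut_sym_diff Y(1) using d by blast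
    then have "F \<inter> \<delta> X1 \<inter> D \<subset> F \<inter> \<delta> X \<inter> D"
      using d by blast
    then have "card (F \<inter> \<delta> X1 \<inter> D) < card (F \<inter> \<delta> X \<inter> D)"
      by (simp add: psubset_card_mono)
    from less[OF this] obtain X' where
      "F \<inter> \<delta> X' = F \<inter> \<delta> X1 - D" "(p \<in> X' \<longleftrightarrow> q \<in> X') \<longleftrightarrow> (p \<in> X1 \<longleftrightarrow> q \<in> X1)" by blast
    moreover have "(p \<in> X1 \<longleftrightarrow> q \<in> X1) \<longleftrightarrow> (p \<in> X \<longleftrightarrow> q \<in> X)"
      unfolding X1_def using Y(2) by blast
    ultimately show ?thesis
      using X1 d by blast
  qed
qed

text \<open>Edges of \<open>D\<close> are now cancelled two at a time, hence one may remain. Read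
  contrapositively, this finds a pair in \<open>D\<close> all of whose cuts separate
  \<open>p\<close> from \<open>q\<close>.\<close>

lemma parity_pairs:
  assumes "\<forall>d\<in>D. \<forall>d'\<in>D. d \<noteq> d' \<longrightarrow> (\<exists>Y. F \<inter> \<delta> Y = {d, d'} \<and> (p \<in> Y \<longleftrightarrow> q \<in> Y))"
  shows "\<exists>X'. F \<inter> \<delta> X' - D = F \<inter> \<delta> X - D \<and> card (F \<inter> \<delta> X' \<inter> D) \<le> 1 \<and>
    ((p \<in> X' \<longleftrightarrow> q \<in> X') \<longleftrightarrow> (p \<in> X \<longleftrightarrow> q \<in> X))"
proof (induction "card (F \<inter> \<delta> X \<inter> D)" arbitrary: X rule: less_induct)
  case less
  show ?case
  proof (cases "card (F \<inter> \<delta> X \<inter> D) \<le> 1")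
    case True
    then show ?thesis by blast
  next
    case False
    then obtain d d' where d: "d \<in> F \<inter> \<delta> X \<inter> D" "d' \<in> F \<inter> \<delta> X \<inter> D" "d \<noteq> d'"
      by (metis card_le_Suc0_iff_eq finite One_nat_def)
    then obtain Y where Y: "F \<inter> \<delta> Y = {d, d'}" "p \<in> Y \<longleftrightarrow> q \<in> Y"
      using assms by blast
    define X1 where "X1 = X - Y \<union> (Y - X)"
    have X1: "F \<inter> \<delta> X1 = F \<inter> \<delta> X - {d, d'}"
      unfolding X1_def cut_sym_diff Y(1) using d by blast
    then have "F \<inter> \<delta> X1 \<inter> D \<subset> F \<inter> \<delta> X \<inter> D"
      using d by blast
    then have "card (F \<inter> \<delta> X1 \<inter> D) < card (F \<inter> \<delta> X \<inter> D)"
      by (simp add: psubset_card_mono)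
    from less[OF this] obtain X' where
      X': "F \<inter> \<delta> X' - D = F \<inter> \<delta> X1 - D" "card (F \<inter> \<delta> X' \<inter> D) \<le> 1"
         "(p \<in> X' \<longleftrightarrow> q \<in> X') \<longleftrightarrow> (p \<in> X1 \<longleftrightarrow> q \<in> X1)" by blast
    have "(p \<in> X1 \<longleftrightarrow> q \<in> X1) \<longleftrightarrow> (p \<in> X \<longleftrightarrow> q \<in> X)"
      unfolding X1_def using Y(2) by blast
    moreover have "F \<inter> \<delta> X1 - D = F \<inter> \<delta> X - D"
      using X1 d by blast
    ultimately show ?thesis
      using X' by blast
  qed
qed

lemma bridges_Diff_bridges: "bridges (F - bridges F) = {}"
proof (rule ccontr)
  assume "bridges (F - bridges F) \<noteq> {}"
  then obtain d X where X: "(F - bridges F) \<inter> \<delta> X = {d}"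
    unfolding bridges_def by blast
  \<comment> \<open>No separation has to be tracked here, so \<open>p\<close> and \<open>q\<close>
    are the same dummy vertex.\<close>
  have "\<forall>b\<in>bridges F. \<exists>Y. F \<inter> \<delta> Y = {b} \<and> (undefined \<in> Y \<longleftrightarrow> undefined \<in> Y)"
    unfolding bridges_def by blast
  from parity_bridges[OF this, of X] obtain X' where "F \<inter> \<delta> X' = F \<inter> \<delta> X - bridges F"
    by blast
  then have "F \<inter> \<delta> X' = {d}"
    using X by blast
  then have "d \<in> bridges F"
    unfolding bridges_def by blast
  then show False
    using X by blast
qed

lemma series_refl [simp]: "series F f f"
  by (simp add: series_def)

lemma series_sym: "series F f g \<Longrightarrow> series F g f"
  by (auto simp: series_def insert_commute)

lemma series_trans:
  assumes "bridges F = {}" "series F f g" "series F g h"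
  shows "series F f h"
proof (cases "f = g \<or> g = h \<or> f = h")
  case True
  then show ?thesis using assms by auto
next
  case False
  then obtain X Y where XY: "F \<inter> \<delta> X = {f, g}" "F \<inter> \<delta> Y = {g, h}"
    using assms unfolding series_def by blast
  have "F \<inter> \<delta> (X - Y \<union> (Y - X)) = {f, h}"
    unfolding cut_sym_diff XY using False by blast
  then show ?thesis unfolding series_def by blast
qed

text \<open>A 2-edge cut of \<open>F\<close> meets the bridgeless set \<open>H\<close> in both edges
  or in none, since a single edge would be a bridge of \<open>H\<close>.\<close>

lemma series_subset:
  assumes "bridges H = {}" "H \<subseteq> F" "f \<in> H" "series F f g"
  shows "g \<in> H" "series H f g"
proof -
  have "g \<in> H \<and> series H f g"
  proof (cases "f = g")
    case True
    then show ?thesis using assms by simp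
  next
    case False
    then obtain X where X: "F \<inter> \<delta> X = {f, g}"
      using assms(4) unfolding series_def by blast
    have "H \<inter> \<delta> X \<noteq> {f}"
      by (rule cut_not_single[OF assms(1)])
    then have "H \<inter> \<delta> X = {f, g}"
      using X assms(2,3) by blast
    then show ?thesis unfolding series_def by blast
  qed
  then show "g \<in> H" "series H f g" by auto
qed

lemma cls_subset: "bridges H = {} \<Longrightarrow> H \<subseteq> F \<Longrightarrow> f \<in> H \<Longrightarrow> cls F f \<subseteq> H"
  unfolding cls_def using series_subset(1) by blast

lemma cls_eq:
  assumes "bridges F = {}" "series F f g"
  shows "cls F f = cls F g"
  unfolding cls_def using series_trans[OF assms(1)] series_sym assms(2) by blast

text \<open>Let \<open>d\<close> be a bridge of the remainder. In the corresponding cut of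
  \<open>F\<close> the edges of the class cancel in pairs down to at most one edge \<open>c\<close>,
  so \<open>d\<close> is a bridge of \<open>F\<close> or in series with \<open>c\<close>.\<close>

lemma bridgeless_Diff_cls:
  assumes "bridges F = {}"
  shows "bridges (F - cls F f) = {}"
proof (rule ccontr)
  assume "bridges (F - cls F f) \<noteq> {}"
  then obtain d X where X: "(F - cls F f) \<inter> \<delta> X = {d}"
    unfolding bridges_def by blast
  have "series F c c'" if "c \<in> cls F f" "c' \<in> cls F f" for c c'
    using that series_trans[OF assms] series_sym unfolding cls_def by blast
  then have "\<forall>c\<in>cls F f. \<forall>c'\<in>cls F f. c \<noteq> c' \<longrightarrow>
      (\<exists>Y. F \<inter> \<delta> Y = {c, c'} \<and> (undefined \<in> Y \<longleftrightarrow> undefined \<in> Y))"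
    unfolding series_def by blast
  from parity_pairs[OF this, of X] obtain X' where
    X': "F \<inter> \<delta> X' - cls F f = F \<inter> \<delta> X - cls F f" "card (F \<inter> \<delta> X' \<inter> cls F f) \<le> 1" by blast
  have d: "F \<inter> \<delta> X' - cls F f = {d}"
    using X' X by blast
  show False
  proof (cases "F \<inter> \<delta> X' \<inter> cls F f = {}")
    case True
    then have "F \<inter> \<delta> X' = {d}" using d by blast
    then show False using cut_not_single[OF assms] by blast
  next
    case False
    then obtain c where c: "F \<inter> \<delta> X' \<inter> cls F f = {c}"
      using X'(2) by (metis One_nat_def card_le_Suc0_iff_eq finite is_singletonI' is_singleton_the_elem)
    then have "F \<inter> \<delta> X' = {c, d}" using d by blast
    then have "series F c d" unfolding series_def by blast
    moreover have "series F f c" using c unfolding cls_def by blast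
    ultimately have "d \<in> cls F f"
      using series_trans[OF assms] unfolding cls_def by blast
    then show False using X by blast
  qed
qed

lemma reach_closed: "F \<inter> \<delta> (reach F r) = {}"
proof -
  have "src e \<in> reach F r \<longleftrightarrow> tgt e \<in> reach F r" if "e \<in> F" for e
    unfolding reach_def using closedD[OF _ that] by blast
  then show ?thesis by (auto simp: in_cut)
qed

lemma ends_reach: "src r \<in> reach F r" "tgt r \<in> reach F r"
  unfolding reach_def by (auto simp: ends_subset)

lemma reach_subset: "F \<inter> \<delta> X = {} \<Longrightarrow> src r \<in> X \<Longrightarrow> tgt r \<in> X \<Longrightarrow> reach F r \<subseteq> X"
  unfolding reach_def by (auto simp: ends_subset)

lemma in_block: "e \<in> block F r \<longleftrightarrow> e \<in> F \<and> src e \<in> reach F r \<and> tgt e \<in> reach F r"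
  by (simp add: block_def ends_subset)

lemma in_block_iff:
  "e \<in> block F r \<longleftrightarrow> e \<in> F \<and> (\<forall>X. F \<inter> \<delta> X = {} \<and> src r \<in> X \<and> tgt r \<in> X \<longrightarrow> src e \<in> X)"
proof -
  have "e \<in> F \<Longrightarrow> src e \<in> reach F r \<Longrightarrow> tgt e \<in> reach F r"
    using closedD[OF reach_closed[of F r]] by blast
  then show ?thesis
    unfolding in_block by (auto simp: reach_def ends_subset)
qed

lemma block_subset: "block F r \<subseteq> F"
  by (auto simp: in_block)

text \<open>Every cut of a component is a cut of \<open>F\<close> at a set inside
  \<open>reach F r\<close>, so a component of a bridgeless set is bridgeless.\<close>

lemma block_cut: "block F r \<inter> \<delta> X = F \<inter> \<delta> (X \<inter> reach F r)"
  using closedD[OF reach_closed[of F r]] by (auto simp: in_cut in_block)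

lemma reach_subset_block:
  assumes "block F r \<inter> \<delta> X = {}" "src r \<in> X" "tgt r \<in> X"
  shows "reach F r \<subseteq> X"
proof -
  have "reach F r \<subseteq> X \<inter> reach F r"
    by (rule reach_subset) (use assms ends_reach block_cut in auto)
  then show ?thesis by blast
qed

lemma block_self: "r \<in> F \<Longrightarrow> r \<in> block F r"
  by (simp add: in_block ends_reach)

lemma block_tec:
  assumes "bridges F = {}" "r \<in> F"
  shows "tec (block F r)"
  unfolding tec_def
proof (intro conjI allI impI)
  show "bridges (block F r) = {}"
    using assms(1) unfolding bridges_def block_cut by blast
next
  fix X
  assume X: "block F r \<inter> \<delta> X = {}"
  have r: "r \<in> block F r" by (rule block_self[OF assms(2)])
  show "(\<forall>e\<in>block F r. ends e \<subseteq> X) \<or> (\<forall>e\<in>block F r. ends e \<inter> X = {})"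
  proof (cases "src r \<in> X")
    case True
    then have "tgt r \<in> X" using closedD[OF X r] by blast
    then have "reach F r \<subseteq> X" using reach_subset_block X True by blast
    then show ?thesis by (auto simp: in_block ends_subset)
  next
    case False
    then have "tgt r \<notin> X" using closedD[OF X r] by blast
    then have "reach F r \<subseteq> - X" using reach_subset_block[of F r "- X"] X False by (simp add: cut_Compl)
    then show ?thesis by (auto simp: in_block ends_disjoint)
  qed
qed

lemma tec_subset_block:
  assumes "tec H" "H \<subseteq> F" "e \<in> H" "e \<in> block F r"
  shows "H \<subseteq> block F r"
proof
  fix f assume f: "f \<in> H"
  have "src f \<in> X" if X: "F \<inter> \<delta> X = {} \<and> src r \<in> X \<and> tgt r \<in> X" for X
  proof -
    have "src e \<in> X" using assms(4) X in_block_iff by blast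
    moreover have "H \<inter> \<delta> X = {}" using X assms(2) by blast
    ultimately show ?thesis using tec_not_separated assms(1,3) f by blast
  qed
  then show "f \<in> block F r" using in_block_iff f assms(2) by blast
qed

lemma block_sym:
  assumes "e \<in> block F r" "r \<in> F"
  shows "r \<in> block F e"
proof -
  have "src r \<in> X" if X: "F \<inter> \<delta> X = {} \<and> src e \<in> X \<and> tgt e \<in> X" for X
  proof (rule ccontr)
    assume "src r \<notin> X"
    then have "tgt r \<notin> X" using X assms(2) closedD by blast
    then have "reach F r \<subseteq> - X"
      using reach_subset[of F "- X" r] X \<open>src r \<notin> X\<close> by (simp add: cut_Compl)
    then show False using assms(1) X by (auto simp: in_block)
  qed
  then show ?thesis using in_block_iff assms(2) by blast
qed

lemma block_trans:
  assumes "e \<in> block F f" "f \<in> block F r"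
  shows "e \<in> block F r"
  using assms unfolding in_block by (meson reach_closed reach_subset subsetD)

section \<open>Weights of series classes\<close>

lemma sum_union_of_classes:
  fixes w :: "'e \<Rightarrow> real"
  assumes "bridges F = {}"
    and "\<And>e. e \<in> H \<Longrightarrow> cls F e \<subseteq> H"
    and "\<And>e. e \<in> H \<Longrightarrow> sum w (cls F e) = 0"
  shows "sum w H = 0"
  using assms(2,3)
proof (induction "card H" arbitrary: H rule: less_induct)
  case less
  show ?case
  proof (cases "H = {}")
    case False
    then obtain e where e: "e \<in> H" by blast
    then have sub: "cls F e \<subseteq> H" using less by blast
    have "e \<in> cls F e" by (simp add: cls_def)
    then have "H - cls F e \<subset> H" using e by blast
    then have "card (H - cls F e) < card H" by (simp add: psubset_card_mono)
    moreover have "cls F f \<subseteq> H - cls F e" if "f \<in> H - cls F e" for f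
      using that less.prems(1)[of f] series_trans[OF assms(1)] series_sym unfolding cls_def by blast
    moreover have "sum w (cls F f) = 0" if "f \<in> H - cls F e" for f
      using that less.prems(2)[of f] by blast
    ultimately have "sum w (H - cls F e) = 0" using less.hyps by blast
    moreover have "sum w H = sum w (H - cls F e) + sum w (cls F e)"
      using sub by (simp add: sum.subset_diff)
    ultimately show ?thesis using less.prems(2)[OF e] by simp
  qed simp
qed

text \<open>Induction on the component \<open>K\<close> of \<open>r\<close> in \<open>F - cls F f\<close>: deleting a class \<open>D\<close> of \<open>F\<close> outside
  \<open>K\<close> instead of \<open>cls F f\<close> leaves a strictly larger component, so \<open>D\<close> has weight 0, and
  \<open>cls F f\<close> has the weight of \<open>F\<close> minus that of \<open>K\<close>.\<close>

lemma removable_class_zero: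
  fixes w :: "'e \<Rightarrow> real"
  assumes F: "tec F" and r: "r \<in> R"
    and w: "\<And>H. tec H \<Longrightarrow> R \<subseteq> H \<Longrightarrow> H \<subseteq> F \<Longrightarrow> sum w H = 0"
    and f: "f \<in> F" and R: "R \<subseteq> block (F - cls F f) r"
  shows "sum w (cls F f) = 0"
  using f R
proof (induction "card (F - block (F - cls F f) r)" arbitrary: f rule: less_induct)
  case less
  note bF = tec_bridges[OF F]
  let ?C = "cls F f"
  let ?K = "block (F - ?C) r"
  have CF: "?C \<subseteq> F" using cls_subset[OF bF] less.prems by blast
  have fC: "f \<in> ?C" by (simp add: cls_def)
  have rK: "r \<in> ?K" and rFC: "r \<in> F - ?C" using less.prems(2) r block_subset by blast+
  have tK: "tec ?K" by (rule block_tec[OF bridgeless_Diff_cls[OF bF] rFC])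
  have KF: "?K \<subseteq> F - ?C" by (rule block_subset)
  have zero: "sum w (cls F d) = 0" if d: "d \<in> F - ?C - ?K" for d
  proof -
    let ?D = "cls F d"
    let ?L = "block (F - ?D) r"
    have DF: "?D \<subseteq> F" using cls_subset[OF bF] d by blast
    have dD: "d \<in> ?D" by (simp add: cls_def)
    have DK: "?D \<inter> ?K = {}"
    proof (rule ccontr)
      assume "?D \<inter> ?K \<noteq> {}"
      then obtain c where c: "c \<in> ?K" "series F d c" unfolding cls_def by blast
      then have "d \<in> ?K"
        using series_subset(1)[OF tec_bridges[OF tK] _ c(1) series_sym[OF c(2)]] KF by blast
      then show False using d by blast
    qed
    have CD: "?C \<inter> ?D = {}"
      using d series_trans[OF bF] series_sym unfolding cls_def by blast
    have rFD: "r \<in> F - ?D" using rK DK rFC by blast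
    have KL: "?K \<subseteq> ?L"
      by (rule tec_subset_block[OF tK _ rK block_self[OF rFD]]) (use KF DK in blast)
    have tL: "tec ?L" by (rule block_tec[OF bridgeless_Diff_cls[OF bF] rFD])
    \<comment> \<open>If the components agreed, no edge of \<open>F\<close> would leave the
      intersection of both reaches: the class of \<open>f\<close> lies outside \<open>?Y\<close>,
      and the class of \<open>d\<close> misses \<open>?K\<close>. The intersection contains the ends
      of \<open>r\<close> but not those of \<open>f\<close>, against the connectivity of
      \<open>F\<close>.\<close>
    have "?K \<noteq> ?L"
    proof
      assume KLeq: "?K = ?L"
      let ?X = "reach (F - ?C) r"
      let ?Y = "reach (F - ?D) r"
      have X: "(F - ?C) \<inter> \<delta> ?X = {}" and Y: "(F - ?D) \<inter> \<delta> ?Y = {}" by (rule reach_closed)+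
      have Cout: "src c \<notin> ?Y \<and> tgt c \<notin> ?Y" if "c \<in> ?C" for c
      proof -
        have "c \<in> F - ?D" using that CF CD by blast
        moreover have "c \<notin> ?L" using that KLeq KF by blast
        ultimately show ?thesis using closedD[OF Y] in_block by blast
      qed
      have "F \<inter> \<delta> (?X \<inter> ?Y) = {}"
      proof (rule ccontr)
        assume "F \<inter> \<delta> (?X \<inter> ?Y) \<noteq> {}"
        then obtain e where e: "e \<in> F" "(src e \<in> ?X \<inter> ?Y) \<noteq> (tgt e \<in> ?X \<inter> ?Y)"
          using not_closedD by blast
        have eC: "e \<notin> ?C" using Cout e by blast
        then have "src e \<in> ?X" "tgt e \<in> ?X" using e closedD[OF X, of e] by blast+
        then have eK: "e \<in> ?K" using e eC in_block by blast
        then have "e \<notin> ?D" using DK by blast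
        then show False using e closedD[OF Y, of e] \<open>src e \<in> ?X\<close> \<open>tgt e \<in> ?X\<close> by blast
      qed
      moreover have "src r \<in> ?X \<inter> ?Y" using ends_reach by blast
      ultimately have "src f \<in> ?X \<inter> ?Y"
        using tec_not_separated[OF F] rFC less.prems(1) by blast
      then show False using Cout fC by blast
    qed
    then have "F - ?L \<subset> F - ?K" using KL KF block_subset[of "F - ?D" r] by blast
    then have "card (F - ?L) < card (F - ?K)" by (simp add: psubset_card_mono)
    moreover have "R \<subseteq> ?L" using less.prems(2) KL by blast
    ultimately show ?thesis using less.hyps d by blast
  qed
  have "cls F d \<subseteq> F - ?C - ?K" if d: "d \<in> F - ?C - ?K" for d
  proof
    fix c assume "c \<in> cls F d"
    then have c: "series F d c" by (simp add: cls_def)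
    have "c \<in> F" using series_subset(1)[OF bF _ _ c] d by blast
    moreover have "c \<notin> ?C" using d c series_trans[OF bF] series_sym unfolding cls_def by blast
    moreover have "c \<notin> ?K"
      using series_subset(1)[OF tec_bridges[OF tK] _ _ series_sym[OF c]] KF d by blast
    ultimately show "c \<in> F - ?C - ?K" by blast
  qed
  then have "sum w (F - ?C - ?K) = 0"
    using sum_union_of_classes[OF bF] zero by blast
  moreover have "sum w ?K = 0" using w[OF tK] less.prems(2) KF by blast
  moreover have "sum w F = 0" using w[OF F] less.prems(2) KF by blast
  moreover have "sum w F = sum w (F - ?C - ?K) + sum w ?K + sum w ?C"
    using KF CF by (simp add: sum.subset_diff)
  ultimately show ?case by simp
qed

text \<open>A class avoiding \<open>r\<close> is removable with \<open>R = {r}\<close>. The class of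
  \<open>r\<close> is \<open>F\<close> minus such classes, and \<open>F\<close> itself has weight
  0.\<close>

lemma all_classes_zero:
  fixes w :: "'e \<Rightarrow> real"
  assumes F: "tec F" and r: "r \<in> F"
    and w: "\<And>H. tec H \<Longrightarrow> r \<in> H \<Longrightarrow> H \<subseteq> F \<Longrightarrow> sum w H = 0"
    and f: "f \<in> F"
  shows "sum w (cls F f) = 0"
proof -
  note bF = tec_bridges[OF F]
  have out: "sum w (cls F f) = 0" if "f \<in> F" "r \<notin> cls F f" for f
    by (rule removable_class_zero[OF F, of r "{r}"]) (use that w r block_self in auto)
  show ?thesis
  proof (cases "r \<in> cls F f")
    case True
    have CF: "cls F f \<subseteq> F" using cls_subset[OF bF] f by blast
    have "sum w (F - cls F f) = 0"
    proof (rule sum_union_of_classes[OF bF])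
      fix e assume e: "e \<in> F - cls F f"
      then show "cls F e \<subseteq> F - cls F f"
        using cls_subset[OF bF, of F e] series_trans[OF bF] series_sym unfolding cls_def by blast
      then show "sum w (cls F e) = 0" using out True e by blast
    qed
    moreover have "sum w F = 0" using w F r by blast
    moreover have "sum w F = sum w (F - cls F f) + sum w (cls F f)"
      using CF by (simp add: sum.subset_diff)
    ultimately show ?thesis by simp
  qed (use out f in blast)
qed

lemma core_subset: "core F r \<subseteq> F - bridges F"
  unfolding core_def by (rule block_subset)

lemma core_tec: "r \<in> F - bridges F \<Longrightarrow> tec (core F r)"
  unfolding core_def by (rule block_tec[OF bridges_Diff_bridges])

lemma core_self: "r \<in> F - bridges F \<Longrightarrow> r \<in> core F r"
  unfolding core_def by (rule block_self)

lemma tec_subset_core: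
  assumes "tec H" "H \<subseteq> F" "e \<in> H" "e \<in> core F r"
  shows "H \<subseteq> core F r"
proof -
  have "H \<subseteq> F - bridges F"
    using bridgeless_subset_bridges[OF tec_bridges] assms by blast
  then show ?thesis
    using tec_subset_block assms unfolding core_def by blast
qed

text \<open>A set closed under \<open>F - bridges F\<close> becomes one closed under
  \<open>F\<close> by cancelling bridges along cuts that do not separate \<open>r\<close> from
  \<open>e\<close>; connectivity can therefore be tested in \<open>F\<close>.\<close>

lemma in_coreI:
  assumes "e \<in> F - bridges F"
    and b: "\<forall>b\<in>bridges F. \<exists>Y. F \<inter> \<delta> Y = {b} \<and> (src r \<in> Y \<longleftrightarrow> src e \<in> Y)"
    and c: "\<And>X. F \<inter> \<delta> X = {} \<Longrightarrow> src r \<in> X \<longleftrightarrow> src e \<in> X"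
  shows "e \<in> core F r"
  unfolding core_def in_block_iff
proof (intro conjI allI impI)
  fix X assume X: "(F - bridges F) \<inter> \<delta> X = {} \<and> src r \<in> X \<and> tgt r \<in> X"
  obtain X' where X': "F \<inter> \<delta> X' = F \<inter> \<delta> X - bridges F"
    "(src r \<in> X' \<longleftrightarrow> src e \<in> X') \<longleftrightarrow> (src r \<in> X \<longleftrightarrow> src e \<in> X)"
    using parity_bridges[OF b, of X] by blast
  then have "F \<inter> \<delta> X' = {}" using X by blast
  then show "src e \<in> X" using c X' X by blast
qed (use assms in auto)

lemma core_cut_lift:
  assumes "core F r \<inter> \<delta> X = C"
  shows "\<exists>X'. F \<inter> \<delta> X' = C"
proof -
  let ?X = "X \<inter> reach (F - bridges F) r"
  have X: "(F - bridges F) \<inter> \<delta> ?X = C"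
    using assms block_cut unfolding core_def by blast
  have "\<forall>b\<in>bridges F. \<exists>Y. F \<inter> \<delta> Y = {b} \<and> (undefined \<in> Y \<longleftrightarrow> undefined \<in> Y)"
    unfolding bridges_def by blast
  from parity_bridges[OF this, of ?X] obtain X' where "F \<inter> \<delta> X' = F \<inter> \<delta> ?X - bridges F"
    by blast
  then show ?thesis using X by blast
qed

end

section \<open>Minimal cuts and tight subgraphs\<close>

context multigraph
begin

lemma cut_Int_subset: "\<delta> (X \<inter> Y) \<subseteq> \<delta> X \<union> \<delta> Y"
  by (auto simp: in_cut)

lemma cut_Diff_subset: "\<delta> (X - Y) \<subseteq> \<delta> X \<union> \<delta> Y"
  by (auto simp: in_cut)

section \<open>Paths and component counts translated into cuts\<close>

lemma adj_rtrancl_iff: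
  "(u, v) \<in> (adj ends F)\<^sup>* \<longleftrightarrow> (\<forall>X. F \<inter> \<delta> X = {} \<and> u \<in> X \<longrightarrow> v \<in> X)"
proof (intro iffI allI impI)
  fix X
  assume "(u, v) \<in> (adj ends F)\<^sup>*" and X: "F \<inter> \<delta> X = {} \<and> u \<in> X"
  then show "v \<in> X"
  proof (induction rule: rtrancl_induct)
    case (step y z)
    then obtain e where e: "e \<in> F" "ends e = {y, z}" by (auto simp: adj_def)
    have "src e \<in> X \<longleftrightarrow> tgt e \<in> X" using closedD X e by blast
    then show ?case using step e ends_eq[of e] by (auto simp: doubleton_eq_iff)
  qed simp
next
  assume all: "\<forall>X. F \<inter> \<delta> X = {} \<and> u \<in> X \<longrightarrow> v \<in> X"
  let ?X = "{x. (u, x) \<in> (adj ends F)\<^sup>*}"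
  have "F \<inter> \<delta> ?X = {}"
  proof (rule ccontr)
    assume "F \<inter> \<delta> ?X \<noteq> {}"
    then obtain e where e: "e \<in> F" "(src e \<in> ?X) \<noteq> (tgt e \<in> ?X)" using not_closedD by blast
    have "(src e, tgt e) \<in> adj ends F" "(tgt e, src e) \<in> adj ends F"
      using e ends_eq[of e] by (auto simp: adj_def)
    then have "src e \<in> ?X \<longleftrightarrow> tgt e \<in> ?X"
      by (metis (no_types, lifting) mem_Collect_eq rtrancl.rtrancl_into_rtrancl)
    then show False using e(2) by blast
  qed
  then show "(u, v) \<in> (adj ends F)\<^sup>*" using all by blast
qed

text \<open>The map \<open>?\<phi>\<close> sends each component of \<open>F - {f}\<close> onto the
  component of \<open>F\<close> containing it. A one-edge cut at \<open>f\<close> keeps the ends of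
  \<open>f\<close> in different components of \<open>F - {f}\<close>, which \<open>?\<phi>\<close>
  identifies, so the count grows strictly. Without such a cut, \<open>F\<close> and
  \<open>F - {f}\<close> have the same closed sets and the same components.\<close>

lemma is_bridge_iff:
  assumes "is_subgraph ends W F"
  shows "is_bridge ends W F f \<longleftrightarrow> f \<in> bridges F"
proof
  assume f: "f \<in> bridges F"
  then have fF: "f \<in> F" using bridges_subset by blast
  let ?c = "\<lambda>F v. {u \<in> W. (v, u) \<in> (adj ends F)\<^sup>*}"
  let ?\<phi> = "\<lambda>C. {u \<in> W. \<exists>c\<in>C. (c, u) \<in> (adj ends F)\<^sup>*}"
  have sub: "(adj ends (F - {f}))\<^sup>* \<subseteq> (adj ends F)\<^sup>*"
    by (rule rtrancl_mono) (auto simp: adj_def)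
  have \<phi>: "?\<phi> (?c (F - {f}) v) = ?c F v" if "v \<in> W" for v
  proof
    show "?\<phi> (?c (F - {f}) v) \<subseteq> ?c F v"
      using sub rtrancl_trans[of v _ "adj ends F"] by blast
    show "?c F v \<subseteq> ?\<phi> (?c (F - {f}) v)"
      using that by auto
  qed
  have img: "comps ends W F = ?\<phi> ` comps ends W (F - {f})"
    unfolding comps_def image_image using \<phi> by (intro image_cong) auto
  have W: "src f \<in> W" "tgt f \<in> W"
    using assms fF by (auto simp: is_subgraph_def ends_subset)
  obtain X where X: "F \<inter> \<delta> X = {f}" using f by (auto simp: bridges_def)
  have f1: "(src f, tgt f) \<in> adj ends F" "(tgt f, src f) \<in> adj ends F"
    using fF ends_eq[of f] by (auto simp: adj_def)
  have "\<not> inj_on ?\<phi> (comps ends W (F - {f}))"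
  proof
    assume inj: "inj_on ?\<phi> (comps ends W (F - {f}))"
    have "?c F (src f) = ?c F (tgt f)"
      using f1 converse_rtrancl_into_rtrancl[of "src f" "tgt f"] converse_rtrancl_into_rtrancl[of "tgt f" "src f"]
      by blast
    then have "?\<phi> (?c (F - {f}) (src f)) = ?\<phi> (?c (F - {f}) (tgt f))"
      using \<phi>[OF W(1)] \<phi>[OF W(2)] by simp
    moreover have "?c (F - {f}) (src f) \<in> comps ends W (F - {f})"
      "?c (F - {f}) (tgt f) \<in> comps ends W (F - {f})"
      unfolding comps_def using W by blast+
    ultimately have "?c (F - {f}) (src f) = ?c (F - {f}) (tgt f)"
      by (rule inj_onD[OF inj])
    then have 1: "(src f, tgt f) \<in> (adj ends (F - {f}))\<^sup>*" "(tgt f, src f) \<in> (adj ends (F - {f}))\<^sup>*"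
      using W by auto
    have "(F - {f}) \<inter> \<delta> X = {}" using X by blast
    then have "src f \<in> X \<longleftrightarrow> tgt f \<in> X" using 1 unfolding adj_rtrancl_iff by blast
    then show False using X in_cut[of f X] by blast
  qed
  then have "card (comps ends W F) < card (comps ends W (F - {f}))"
    unfolding img by (simp add: card_image_le inj_on_iff_eq_card order_neq_le_trans)
  then show "is_bridge ends W F f" unfolding is_bridge_def using fF by blast
next
  assume b: "is_bridge ends W F f"
  show "f \<in> bridges F"
  proof (rule ccontr)
    assume f: "f \<notin> bridges F"
    have "(F - {f}) \<inter> \<delta> X = {} \<longleftrightarrow> F \<inter> \<delta> X = {}" for X
      using f unfolding bridges_def by blast
    then have "comps ends W (F - {f}) = comps ends W F"
      unfolding comps_def adj_rtrancl_iff by simp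
    then show False using b by (simp add: is_bridge_def)
  qed
qed

lemma two_edge_connected_iff:
  assumes "is_subgraph ends W F"
  shows "two_edge_connected ends W F \<longleftrightarrow>
    bridges F = {} \<and> (\<forall>X. F \<inter> \<delta> X = {} \<longrightarrow> W \<subseteq> X \<or> W \<inter> X = {})"
proof -
  have "(\<forall>u\<in>W. \<forall>v\<in>W. \<forall>X. F \<inter> \<delta> X = {} \<and> u \<in> X \<longrightarrow> v \<in> X) \<longleftrightarrow>
      (\<forall>X. F \<inter> \<delta> X = {} \<longrightarrow> W \<subseteq> X \<or> W \<inter> X = {})"
    by (auto simp: subset_iff disjoint_iff)
  moreover have "(\<forall>e\<in>F. e \<notin> bridges F) \<longleftrightarrow> bridges F = {}"
    using bridges_subset[of F] by auto
  ultimately show ?thesis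
    unfolding two_edge_connected_def is_bridge_iff[OF assms] g_connected_def adj_rtrancl_iff
    by (simp add: conj_commute)
qed

lemma two_edge_connected_tec:
  assumes "is_subgraph ends W F" "two_edge_connected ends W F"
  shows "tec F"
  using assms(2) assms(1)[unfolded is_subgraph_def]
  unfolding tec_def two_edge_connected_iff[OF assms(1)] by blast

lemma tec_two_edge_connected:
  assumes "tec F"
  shows "is_subgraph ends (\<Union> (ends ` F)) F \<and> two_edge_connected ends (\<Union> (ends ` F)) F"
proof
  show sub: "is_subgraph ends (\<Union> (ends ` F)) F"
    by (auto simp: is_subgraph_def)
  show "two_edge_connected ends (\<Union> (ends ` F)) F"
    unfolding two_edge_connected_iff[OF sub] using assms unfolding tec_def by blast
qed

lemma TECSP_eq: "TECSP ends = convex hull (incidence ` {F. tec F})"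
proof -
  have "{incidence F |W F. is_subgraph ends W F \<and> two_edge_connected ends W F} = incidence ` {F. tec F}"
    using two_edge_connected_tec tec_two_edge_connected by blast
  then show ?thesis by (simp add: TECSP_def)
qed

lemma is_bridge_induced: "is_bridge ends W (induced_edges ends W) f \<longleftrightarrow> f \<in> bridges (induced_edges ends W)"
  by (rule is_bridge_iff) (auto simp: is_subgraph_def induced_edges_def)

text \<open>If \<open>X\<close> splits \<open>G[S]\<close>, the cuts of \<open>S \<inter> X\<close>
  and \<open>S - X\<close> lie in \<open>\<delta> S\<close> and equal it by minimality. But an edge
  of \<open>\<delta> S\<close> has only one end in \<open>S\<close>.\<close>

lemma min_cut_connected:
  assumes tec: "two_edge_connected ends UNIV UNIV" and mc: "min_cut ends S"
    and X: "induced_edges ends S \<inter> \<delta> X = {}"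
  shows "S \<subseteq> X \<or> S \<inter> X = {}"
proof (rule ccontr)
  assume "\<not> (S \<subseteq> X \<or> S \<inter> X = {})"
  then have ne: "S \<inter> X \<noteq> {}" "S - X \<noteq> {}" "S \<inter> X \<noteq> UNIV" "S - X \<noteq> UNIV" by auto
  have edge: "src e \<in> X \<longleftrightarrow> tgt e \<in> X" if "src e \<in> S" "tgt e \<in> S" for e
    using closedD[OF X, of e] that by (simp add: in_induced)
  have "e \<in> \<delta> (S \<inter> X) \<longrightarrow> e \<in> \<delta> S" "e \<in> \<delta> (S - X) \<longrightarrow> e \<in> \<delta> S" for e
    using edge[of e] unfolding in_cut by blast+
  then have "\<delta> (S \<inter> X) \<subseteq> \<delta> S" "\<delta> (S - X) \<subseteq> \<delta> S" by blast+
  then have eq: "\<delta> (S \<inter> X) = \<delta> S" "\<delta> (S - X) = \<delta> S"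
    using mc[unfolded min_cut_def, THEN conjunct2, THEN conjunct2, THEN spec, of "S \<inter> X"]
      mc[unfolded min_cut_def, THEN conjunct2, THEN conjunct2, THEN spec, of "S - X"] ne by metis+
  have S: "S \<noteq> {}" "S \<noteq> UNIV" using mc by (auto simp: min_cut_def)
  have "is_subgraph ends UNIV UNIV" by (simp add: is_subgraph_def)
  then have "UNIV \<inter> \<delta> S \<noteq> {}" using tec S two_edge_connected_iff by blast
  then obtain e where e: "e \<in> \<delta> S" by blast
  then have "e \<in> \<delta> (S \<inter> X)" "e \<in> \<delta> (S - X)" using eq by auto
  then show False using e by (auto simp: in_cut)
qed

end

text \<open>Minimality of the cut enters as connectivity of both sides. The assumptions are
  symmetric under exchanging \<open>S\<close>, \<open>e1\<close> with \<open>- S\<close>,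
  \<open>e2\<close>, so one-sided statements are proved for \<open>S\<close> and transferred by
  \<open>swap\<close>.\<close>

locale cut_graph = multigraph ends
  for ends :: "'e::finite \<Rightarrow> 'v::finite set" +
  fixes S :: "'v set" and e1 e2 :: 'e
  assumes tec_UNIV: "tec UNIV"
    and connected_in: "\<And>X. induced_edges ends S \<inter> \<delta> X = {} \<Longrightarrow> S \<subseteq> X \<or> S \<inter> X = {}"
    and connected_out: "\<And>X. induced_edges ends (- S) \<inter> \<delta> X = {} \<Longrightarrow> - S \<subseteq> X \<or> - S \<inter> X = {}"
    and e1: "e1 \<in> induced_edges ends S" and e2: "e2 \<in> induced_edges ends (- S)"
begin

abbreviation "E \<equiv> induced_edges ends"

lemma swap: "cut_graph ends (- S) e2 e1"
  by unfold_locales (use tec_UNIV connected_in connected_out e1 e2 in auto)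

lemma edge_cases: "e \<in> E S \<or> e \<in> E (- S) \<or> e \<in> \<delta> S"
  by (auto simp: in_cut in_induced)

lemma E_disjoint: "E S \<inter> \<delta> S = {}" "E (- S) \<inter> \<delta> S = {}" "E S \<inter> E (- S) = {}"
  by (auto simp: in_cut in_induced)

lemma ends_e1: "src e1 \<in> S" "tgt e1 \<in> S" and ends_e2: "src e2 \<notin> S" "tgt e2 \<notin> S"
  using e1 e2 by (auto simp: in_induced)

lemma cut_restrict: "E S \<inter> \<delta> (S \<inter> X) = E S \<inter> \<delta> X" "E S \<inter> \<delta> (S - X) = E S \<inter> \<delta> X"
  by (auto simp: in_cut in_induced)

lemma cut_inner: "Y \<subseteq> S \<Longrightarrow> \<delta> Y = (E S \<inter> \<delta> Y) \<union> (\<delta> S \<inter> \<delta> Y)"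
  by (auto simp: in_cut in_induced)

lemma bridgeless_UNIV: "\<delta> X \<noteq> {f}"
  using cut_not_single[OF tec_bridges[OF tec_UNIV]] by simp

lemma cut_S_nonempty: "tec H \<Longrightarrow> e1 \<in> H \<Longrightarrow> e2 \<in> H \<Longrightarrow> H \<inter> \<delta> S \<noteq> {}"
  using tec_not_separated[of H S e1 e2] ends_e1 ends_e2 by blast

lemma card_cut_S_ge2:
  assumes "tec H" "e1 \<in> H" "e2 \<in> H"
  shows "card (H \<inter> \<delta> S) \<ge> 2"
proof -
  have "card (H \<inter> \<delta> S) \<noteq> 0" using cut_S_nonempty assms by simp
  moreover have "card (H \<inter> \<delta> S) \<noteq> 1"
    using cut_not_single[OF tec_bridges[OF assms(1)]] by (metis card_1_singletonE)
  ultimately show ?thesis by linarith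
qed

text \<open>Equality in the inequality, as 2 - 0 or as 2 - 2 + 2. The first disjunct may allow both
  \<open>e1\<close> and \<open>e2\<close>, because \<open>cut_S_nonempty\<close> excludes this for
  \<open>tec\<close> sets.\<close>

definition tight :: "'e set \<Rightarrow> bool" where
  "tight H \<longleftrightarrow> ((e1 \<in> H \<or> e2 \<in> H) \<and> H \<inter> \<delta> S = {}) \<or> (e1 \<in> H \<and> e2 \<in> H \<and> card (H \<inter> \<delta> S) = 2)"

section \<open>Bridges of one side and necessity of the conditions\<close>

lemma bridge_side:
  assumes "f \<in> bridges (E S)" "f \<noteq> e1"
  shows "\<exists>Y. Y \<subseteq> S \<and> E S \<inter> \<delta> Y = {f} \<and> src e1 \<notin> Y \<and> tgt e1 \<notin> Y"
proof -
  obtain X where X: "E S \<inter> \<delta> X = {f}" using assms by (auto simp: bridges_def)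
  have 1: "E S \<inter> \<delta> (S \<inter> X) = {f}" "E S \<inter> \<delta> (S - X) = {f}"
    using X cut_restrict[of X] by simp_all
  have "e1 \<notin> \<delta> X" using X e1 assms(2) by auto
  then have "src e1 \<in> X \<longleftrightarrow> tgt e1 \<in> X" by (simp add: in_cut)
  then show ?thesis
    using 1 by (cases "src e1 \<in> X") (blast intro: exI[of _ "S - X"] exI[of _ "S \<inter> X"])+
qed

text \<open>The components of \<open>G[S] - f\<close> are \<open>Y\<close> and \<open>S - Y\<close>.
  The second contains \<open>e1\<close> and neither contains \<open>e2\<close>, so only
  \<open>Y\<close> contributes.\<close>

lemma delta_Wf_eq:
  assumes Y: "Y \<subseteq> S" "E S \<inter> \<delta> Y = {f}" "src e1 \<notin> Y" "tgt e1 \<notin> Y"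
  shows "delta_Wf ends S e1 e2 S f = \<delta> S \<inter> \<delta> Y"
proof -
  let ?c = "\<lambda>v. {u \<in> S. (v, u) \<in> (adj ends (E S - {f}))\<^sup>*}"
  have f: "f \<in> E S" "src f \<in> Y \<longleftrightarrow> tgt f \<notin> Y" using Y(2) in_cut by auto
  have Ycl: "(E S - {f}) \<inter> \<delta> Y = {}" "(E S - {f}) \<inter> \<delta> (- Y) = {}"
    using Y(2) by (auto simp: cut_Compl)
  have side: "?c v = Z" if v: "v \<in> Z" and Z: "Z = Y \<or> Z = S - Y" for v Z
  proof -
    have sub: "?c v \<subseteq> Z"
    proof
      fix u assume "u \<in> ?c v"
      then have "u \<in> S" "\<And>X. (E S - {f}) \<inter> \<delta> X = {} \<Longrightarrow> v \<in> X \<Longrightarrow> u \<in> X"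
        unfolding adj_rtrancl_iff by blast+
      then show "u \<in> Z" using Ycl v Z by blast
    qed
    \<comment> \<open>If a closed set \<open>X\<close> splits \<open>Z\<close>, then no edge of
      \<open>G[S]\<close> leaves \<open>X \<inter> Z\<close>, or, when \<open>f\<close> leaves that
      set, none leaves \<open>Z - X\<close>. Both contradict the connectivity of
      \<open>G[S]\<close>.\<close>
    moreover have "Z \<subseteq> X" if X: "(E S - {f}) \<inter> \<delta> X = {}" "v \<in> X" for X
    proof (rule ccontr)
      assume "\<not> Z \<subseteq> X"
      have ZS: "Z \<subseteq> S" "E S \<inter> \<delta> Z = {f}"
        using Z Y cut_restrict(2)[of Y] by auto
      then have ex: "\<exists>u\<in>S. u \<notin> Z" using f Z by (auto simp: in_induced)
      have XZ: "(E S - {f}) \<inter> \<delta> (X \<inter> Z) = {}"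
        using X(1) ZS(2) cut_Int_subset[of X Z] by auto
      show False
      proof (cases "f \<in> \<delta> (X \<inter> Z)")
        case True
        then have "E S \<inter> \<delta> (X \<inter> Z) = {f}" using XZ f(1) by auto
        then have "E S \<inter> \<delta> (X \<inter> Z - Z \<union> (Z - X \<inter> Z)) = {}"
          unfolding cut_sym_diff ZS by simp
        moreover have "X \<inter> Z - Z \<union> (Z - X \<inter> Z) = Z - X" by blast
        ultimately have "E S \<inter> \<delta> (Z - X) = {}" by simp
        then have "S \<subseteq> Z - X \<or> S \<inter> (Z - X) = {}" by (rule connected_in)
        then show False using v X ZS \<open>\<not> Z \<subseteq> X\<close> by blast
      next
        case False
        then have "E S \<inter> \<delta> (X \<inter> Z) = {}" using XZ by blast
        then have "S \<subseteq> X \<inter> Z \<or> S \<inter> (X \<inter> Z) = {}" by (rule connected_in)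
        then show False using v X ZS \<open>\<not> Z \<subseteq> X\<close> by blast
      qed
    qed
    moreover have "Z \<subseteq> S" using Z Y(1) by blast
    ultimately show ?thesis
      unfolding adj_rtrancl_iff by (intro equalityI subsetI CollectI conjI allI impI) auto
  qed
  have comps: "comps ends S (E S - {f}) = {Y, S - Y}"
  proof -
    have "(\<exists>v\<in>S. v \<in> Y)" "(\<exists>v\<in>S. v \<in> S - Y)"
      using f by (auto simp: in_induced)
    moreover have "?c v = (if v \<in> Y then Y else S - Y)" if "v \<in> S" for v
      using side[of v] that by auto
    ultimately show ?thesis unfolding comps_def by (auto simp: image_iff)
  qed
  have "\<not> ends e1 \<subseteq> Y" "\<not> ends e2 \<subseteq> Y" "ends e1 \<subseteq> S - Y"
    using Y ends_e1 ends_e2 by (auto simp: ends_subset)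
  then have "delta_Wf ends S e1 e2 S f = {e \<in> \<delta> S. ends e \<inter> Y \<noteq> {}}"
    unfolding delta_Wf_def comps by blast
  also have "\<dots> = \<delta> S \<inter> \<delta> Y"
    using Y(1) by (auto simp: ends_disjoint in_cut)
  finally show ?thesis .
qed

lemma delta_Wf_swap: "delta_Wf ends S e1 e2 W f = delta_Wf ends (- S) e2 e1 W f"
  by (auto simp: delta_Wf_def cut_Compl)

text \<open>If \<open>H\<close> uses two cut edges, they are divided between \<open>Y\<close> and
  \<open>S - Y\<close>. With \<open>f\<close> in \<open>H\<close>, neither set may be left by
  \<open>f\<close> alone, so each gets one. Without \<open>f\<close>, both ends of \<open>e1\<close>
  lie in \<open>S - Y\<close>, which must be left by at least two edges of \<open>H\<close> and so
  takes both.\<close>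

lemma tight_bridge:
  assumes Y: "Y \<subseteq> S" "E S \<inter> \<delta> Y = {f}" and f: "src e1 \<notin> Y \<and> tgt e1 \<notin> Y \<or> f = e1"
    and H: "tec H" "tight H"
  shows "card (H \<inter> (\<delta> S \<inter> \<delta> Y)) = (if f \<in> H then 1 else 0)"
proof -
  have dY: "\<delta> Y = insert f (\<delta> S \<inter> \<delta> Y)" using cut_inner[OF Y(1)] Y(2) by blast
  have "E S \<inter> \<delta> (S - Y) = {f}" "\<delta> S \<inter> \<delta> (S - Y) = \<delta> S - \<delta> Y"
    using Y cut_restrict(2)[of Y] by (auto simp: in_cut[of _ S] in_cut[of _ Y] in_cut[of _ "S - Y"])
  then have dSY: "\<delta> (S - Y) = insert f (\<delta> S - \<delta> Y)" using cut_inner[of "S - Y"] by blast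
  have nf: "f \<notin> \<delta> S" using Y(2) E_disjoint by blast
  note single = cut_not_single[OF tec_bridges[OF H(1)]]
  show ?thesis
  proof (cases "H \<inter> \<delta> S = {}")
    case True
    then have "H \<inter> \<delta> Y = H \<inter> {f}" using dY by blast
    then have "f \<notin> H" using single[of Y f] by blast
    moreover have "H \<inter> (\<delta> S \<inter> \<delta> Y) = {}" using True by blast
    ultimately show ?thesis by (metis card.empty)
  next
    case False
    then have t: "e1 \<in> H" "e2 \<in> H" "card (H \<inter> \<delta> S) = 2" using H(2) unfolding tight_def by auto
    let ?m = "H \<inter> (\<delta> S \<inter> \<delta> Y)" and ?n = "H \<inter> (\<delta> S - \<delta> Y)"
    have "H \<inter> \<delta> S = ?m \<union> ?n" "?m \<inter> ?n = {}" by blast+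
    then have sum: "card ?m + card ?n = 2" using t(3) by (metis card_Un_disjoint finite)
    show ?thesis
    proof (cases "f \<in> H")
      case True
      have "H \<inter> \<delta> Y = insert f ?m" using dY True by blast
      then have "?m \<noteq> {}" using single by metis
      moreover have "H \<inter> \<delta> (S - Y) = insert f ?n" using dSY True by blast
      then have "?n \<noteq> {}" using single by metis
      ultimately have "card ?m \<noteq> 0" "card ?n \<noteq> 0" by simp_all
      then have "card ?m = 1" using sum by linarith
      then show ?thesis using True by simp
    next
      case False
      then have 1: "src e1 \<notin> Y" "tgt e1 \<notin> Y" using f t by auto
      have n: "H \<inter> \<delta> (S - Y) = ?n" unfolding dSY using False by auto
      have "?n \<noteq> {}"
        using tec_not_separated[OF H(1), of "S - Y" e1 e2] t n 1 ends_e1 ends_e2 by auto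
      then have "card ?n \<noteq> 0" by simp
      moreover have "card ?n \<noteq> 1" using n single by (metis card_1_singletonE)
      ultimately have "card ?m = 0" using sum by linarith
      then show ?thesis using False by simp
    qed
  qed
qed

text \<open>The dual form of the spanning condition; \<open>defines_facet_iff\<close> identifies it
  with the facet property.\<close>

definition tight_spans :: bool where
  "tight_spans \<longleftrightarrow> (\<forall>w :: 'e \<Rightarrow> real. (\<forall>H. tec H \<longrightarrow> tight H \<longrightarrow> sum w H = 0) \<longrightarrow>
     (\<forall>H. tec H \<longrightarrow> sum w H = 0))"

lemma tight_spans_bridge:
  assumes "tight_spans" and Y: "Y \<subseteq> S" "E S \<inter> \<delta> Y = {f}"
    and f: "src e1 \<notin> Y \<and> tgt e1 \<notin> Y \<or> f = e1"
  shows "card (\<delta> S \<inter> \<delta> Y) = 1"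
proof -
  \<comment> \<open>The cut edges at \<open>Y\<close> minus \<open>f\<close>: by
    \<open>tight_bridge\<close> this functional vanishes on all tight sets, and its value at
    \<open>G\<close> gives the count.\<close>
  define w :: "'e \<Rightarrow> real" where "w = (\<lambda>e. of_bool (e \<in> \<delta> S \<inter> \<delta> Y) - of_bool (e = f))"
  have w: "sum w H = real (card (H \<inter> (\<delta> S \<inter> \<delta> Y))) - of_bool (f \<in> H)" for H
    unfolding w_def sum_subtractf by (simp add: of_bool_def Int_def flip: sum.inter_filter)
  have "sum w H = 0" if "tec H" "tight H" for H
    unfolding w tight_bridge[OF Y f that] by simp
  then have "sum w UNIV = 0" using assms(1) tec_UNIV unfolding tight_spans_def by blast
  then show ?thesis unfolding w by simp
qed

text \<open>For \<open>f = e1\<close> both sides of the bridge qualify in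
  \<open>tight_spans_bridge\<close>, and together they carry the whole cut.\<close>

lemma tight_spans_e1_bridge:
  assumes "tight_spans" "e1 \<in> bridges (E S)"
  shows "card (\<delta> S) = 2"
proof -
  obtain X where X: "E S \<inter> \<delta> X = {e1}" using assms by (auto simp: bridges_def)
  have 1: "E S \<inter> \<delta> (S \<inter> X) = {e1}" "E S \<inter> \<delta> (S - X) = {e1}"
    using X cut_restrict[of X] by simp_all
  have "card (\<delta> S \<inter> \<delta> (S \<inter> X)) = 1" "card (\<delta> S \<inter> \<delta> (S - X)) = 1"
    using tight_spans_bridge[OF assms(1), of "S \<inter> X" e1] tight_spans_bridge[OF assms(1), of "S - X" e1] 1
    by auto
  moreover have "\<delta> S = (\<delta> S \<inter> \<delta> (S \<inter> X)) \<union> (\<delta> S \<inter> \<delta> (S - X))"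
    "(\<delta> S \<inter> \<delta> (S \<inter> X)) \<inter> (\<delta> S \<inter> \<delta> (S - X)) = {}"
    by (auto simp: in_cut)
  ultimately show ?thesis by (metis card_Un_disjoint finite one_add_one)
qed

section \<open>Exchange of the two sides, and sufficiency in case (i)\<close>

lemma tight_swap: "cut_graph.tight ends (- S) e2 e1 = tight"
  unfolding cut_graph.tight_def[OF swap] tight_def cut_Compl by auto

lemma tight_spans_swap: "cut_graph.tight_spans ends (- S) e2 e1 = tight_spans"
  unfolding cut_graph.tight_spans_def[OF swap] tight_spans_def tight_swap by simp

text \<open>Each side of the bridge carries one of the two cut edges \<open>g\<close>,
  \<open>h\<close>, so both are in series with \<open>e1\<close> in \<open>G\<close>. Hence every
  \<open>tec\<close> set through \<open>e2\<close> is tight: with \<open>e1\<close> it contains both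
  cut edges, without \<open>e1\<close> none.\<close>

lemma e1_bridge_tight_spans:
  assumes e1b: "e1 \<in> bridges (E S)" and c: "card (\<delta> S) = 2"
  shows "tight_spans"
  unfolding tight_spans_def
proof (intro allI impI)
  fix w :: "'e \<Rightarrow> real" and H
  assume w: "\<forall>H. tec H \<longrightarrow> tight H \<longrightarrow> sum w H = 0" and H: "tec H"
  obtain X where X: "E S \<inter> \<delta> X = {e1}" using e1b by (auto simp: bridges_def)
  let ?m = "\<delta> S \<inter> \<delta> (S \<inter> X)" and ?n = "\<delta> S \<inter> \<delta> (S - X)"
  have 1: "E S \<inter> \<delta> (S \<inter> X) = {e1}" "E S \<inter> \<delta> (S - X) = {e1}"
    using X cut_restrict[of X] by simp_all
  have mn: "\<delta> S = ?m \<union> ?n" "?m \<inter> ?n = {}" by (auto simp: in_cut)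
  have dm: "\<delta> (S \<inter> X) = insert e1 ?m" "\<delta> (S - X) = insert e1 ?n"
    using cut_inner[of "S \<inter> X"] cut_inner[of "S - X"] 1 by blast+
  have ne: "?m \<noteq> {}" "?n \<noteq> {}" using dm bridgeless_UNIV by metis+
  have "card ?m + card ?n = 2" using mn c by (metis card_Un_disjoint finite)
  moreover have "card ?m \<noteq> 0" "card ?n \<noteq> 0" using ne by simp_all
  ultimately have "card ?m = 1" "card ?n = 1" by linarith+
  then obtain g h where gh: "?m = {g}" "?n = {h}" by (meson card_1_singletonE)
  have cg: "UNIV \<inter> \<delta> (S \<inter> X) = {e1, g}" "UNIV \<inter> \<delta> (S - X) = {e1, h}" "\<delta> S = {g, h}"
    using dm gh mn by auto
  then have ser: "series UNIV e1 g" "series UNIV e1 h" "series UNIV g e1" "series UNIV h e1"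
    unfolding series_def by (metis insert_commute)+
  have tight: "tight H" if "tec H" "e2 \<in> H" for H
  proof -
    note cl = series_subset(1)[OF tec_bridges[OF that(1)], of UNIV]
    show ?thesis
    proof (cases "e1 \<in> H")
      case True
      then have "g \<in> H" "h \<in> H" using cl ser by blast+
      then have "H \<inter> \<delta> S = \<delta> S" unfolding cg by blast
      then show ?thesis unfolding tight_def using True that c by metis
    next
      case False
      then have "g \<notin> H" "h \<notin> H" using cl ser by blast+
      then have "H \<inter> \<delta> S = {}" unfolding cg by blast
      then show ?thesis unfolding tight_def using that by blast
    qed
  qed
  have "sum w (cls UNIV f) = 0" for f
    by (rule all_classes_zero[OF tec_UNIV, of e2]) (use w tight in auto)
  moreover have "cls UNIV e \<subseteq> H" if "e \<in> H" for e
    using cls_subset[OF tec_bridges[OF H] _ that] by blast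
  ultimately show "sum w H = 0"
    using sum_union_of_classes[OF tec_bridges[OF tec_UNIV]] by blast
qed

end

section \<open>The facet criterion\<close>

text \<open>Since \<open>0 \<in> A\<close>, the polytope has dimension \<open>dim A\<close>. The
  face is the hull of its tight generators \<open>?T\<close>, and its hyperplane misses 0, so its
  dimension is \<open>dim ?T - 1\<close>. A facet thus means equality of the two linear
  dimensions.\<close>

lemma facet_of_convex_hull_iff_span:
  fixes A :: "'a::euclidean_space set"
  assumes "finite A" "0 \<in> A" "b \<noteq> 0" "x0 \<in> A" "x0 \<noteq> 0" and le: "\<And>x. x \<in> A \<Longrightarrow> c \<bullet> x \<le> b"
  shows "{x \<in> convex hull A. c \<bullet> x = b} facet_of convex hull A \<longleftrightarrow> A \<subseteq> span {x \<in> A. c \<bullet> x = b}"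
proof -
  let ?T = "{x \<in> A. c \<bullet> x = b}" and ?F = "{x \<in> convex hull A. c \<bullet> x = b}"
  have "convex hull A \<subseteq> {x. c \<bullet> x \<le> b}"
    by (rule hull_minimal) (use le in \<open>auto simp: convex_halfspace_le\<close>)
  then have "(convex hull A \<inter> {x. c \<bullet> x = b}) face_of convex hull A"
    by (intro face_of_Int_supporting_hyperplane_le convex_convex_hull) auto
  moreover have "convex hull A \<inter> {x. c \<bullet> x = b} = ?F" by blast
  ultimately have face: "?F face_of convex hull A" by simp
  obtain S' where S': "S' \<subseteq> A" "?F = convex hull S'"
    using face_of_convex_hull_subset[OF finite_imp_compact[OF assms(1)] face] by blast
  have F: "?F = convex hull ?T"
  proof
    have "S' \<subseteq> ?F" unfolding S'(2) by (rule hull_subset)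
    then have "S' \<subseteq> ?T" using S'(1) by blast
    then show "?F \<subseteq> convex hull ?T" unfolding S'(2) by (rule hull_mono)
    have "convex ?F" unfolding S'(2) by (rule convex_convex_hull)
    then show "convex hull ?T \<subseteq> ?F" by (intro hull_minimal) (auto intro: hull_inc)
  qed
  have adA: "aff_dim (convex hull A) = int (dim A)"
    using assms(2) by (simp add: aff_dim_convex_hull aff_dim_zero hull_inc)
  have "affine hull ?T \<subseteq> {x. c \<bullet> x = b}"
    by (rule hull_minimal) (auto simp: affine_hyperplane)
  then have "0 \<notin> affine hull ?T" using assms(3) by auto
  then have "aff_dim ?T + 1 = aff_dim (insert 0 ?T)" by (simp add: aff_dim_insert)
  also have "\<dots> = int (dim (insert 0 ?T))" by (intro aff_dim_zero hull_inc) simp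
  also have "\<dots> = int (dim ?T)" by (metis dim_span span_insert_0)
  finally have adT: "aff_dim ?F = int (dim ?T) - 1" unfolding F by (simp add: aff_dim_convex_hull)
  have "?F facet_of convex hull A \<longleftrightarrow> ?T \<noteq> {} \<and> dim ?T = dim A"
    unfolding facet_of_def adA adT using face F by auto
  also have "\<dots> \<longleftrightarrow> A \<subseteq> span ?T"
  proof
    assume "?T \<noteq> {} \<and> dim ?T = dim A"
    then have "span ?T = span A" by (intro dim_eq_span) auto
    then show "A \<subseteq> span ?T" using span_superset by blast
  next
    assume s: "A \<subseteq> span ?T"
    then have "dim A \<le> dim ?T" using dim_subset[OF s] by simp
    moreover have "dim ?T \<le> dim A" by (rule dim_subset) blast
    moreover have "?T \<noteq> {}"
    proof
      assume "?T = {}"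
      with s have "A \<subseteq> span {}" by (simp only:)
      then show False using assms(4,5) by auto
    qed
    ultimately show "?T \<noteq> {} \<and> dim ?T = dim A" by simp
  qed
  finally show ?thesis .
qed

lemma subset_span_iff_orthogonal:
  fixes A T :: "'a::euclidean_space set"
  shows "A \<subseteq> span T \<longleftrightarrow> (\<forall>z. (\<forall>t\<in>T. z \<bullet> t = 0) \<longrightarrow> (\<forall>x\<in>A. z \<bullet> x = 0))"
proof (intro iffI allI impI ballI)
  fix z x
  assume "A \<subseteq> span T" "\<forall>t\<in>T. z \<bullet> t = 0" "x \<in> A"
  then show "z \<bullet> x = 0"
    using orthogonal_to_span[of x T z] by (auto simp: orthogonal_def)
next
  assume z: "\<forall>z. (\<forall>t\<in>T. z \<bullet> t = 0) \<longrightarrow> (\<forall>x\<in>A. z \<bullet> x = 0)"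
  show "A \<subseteq> span T"
  proof
    fix x assume x: "x \<in> A"
    obtain y u where yu: "y \<in> span T" "\<And>v. v \<in> span T \<Longrightarrow> orthogonal u v" "x = y + u"
      using orthogonal_subspace_decomp_exists[of T x] by metis
    have "\<forall>t\<in>T. u \<bullet> t = 0" using yu(2) span_base by (auto simp: orthogonal_def)
    then have "u \<bullet> (y + u) = 0" using z x yu(3) by blast
    moreover have "u \<bullet> y = 0" using yu by (auto simp: orthogonal_def)
    ultimately have "u = 0" by (simp add: inner_add_right)
    then show "x \<in> span T" using yu by simp
  qed
qed

lemma inner_incidence: "x \<bullet> incidence F = xsum x F" for x :: "real ^ 'e::finite"
proof -
  have "x \<bullet> incidence F = (\<Sum>e\<in>UNIV. if e \<in> F then x $ e else 0)"
    unfolding inner_vec_def incidence_def by (intro sum.cong) auto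
  also have "\<dots> = xsum x F" unfolding xsum_def by (simp add: sum.If_cases)
  finally show ?thesis .
qed

context cut_graph
begin

lemma defines_facet_iff:
  "defines_facet (\<lambda>x. 2 * x $ e1 - xsum x (\<delta> S) + 2 * x $ e2) 2 (TECSP ends) \<longleftrightarrow> tight_spans"
proof -
  define c :: "real ^ 'e" where "c = 2 *\<^sub>R axis e1 1 - incidence (\<delta> S) + 2 *\<^sub>R axis e2 1"
  let ?A = "incidence ` {F. tec F} :: (real ^ 'e) set"
  have lhs: "2 * x $ e1 - xsum x (\<delta> S) + 2 * x $ e2 = c \<bullet> x" for x
    unfolding c_def
    by (simp add: inner_commute[of _ x] inner_add_right inner_diff_right inner_axis inner_incidence)
  have val: "c \<bullet> incidence H = 2 * of_bool (e1 \<in> H) - real (card (H \<inter> \<delta> S)) + 2 * of_bool (e2 \<in> H)" for H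
  proof -
    have "xsum (incidence H :: real ^ 'e) (\<delta> S) = real (card (H \<inter> \<delta> S))"
      unfolding xsum_def incidence_def by (simp add: Int_commute flip: sum.inter_restrict)
    then show ?thesis unfolding lhs[symmetric] by (simp add: incidence_def)
  qed
  have le: "c \<bullet> x \<le> 2" if "x \<in> ?A" for x
    using that card_cut_S_ge2 by (auto simp: val of_bool_def)
  have tight: "c \<bullet> incidence H = 2 \<longleftrightarrow> tight H" if "tec H" for H
    unfolding val tight_def using cut_S_nonempty[OF that] by (auto simp: of_bool_def)
  have inc0: "incidence {} = (0 :: real ^ 'e)" by (simp add: incidence_def vec_eq_iff)
  have "tec {}" by (simp add: tec_def bridges_def)
  then have A0: "0 \<in> ?A" by (metis image_eqI inc0 mem_Collect_eq)
  have A1: "incidence UNIV \<in> ?A" using tec_UNIV by blast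
  have A2: "incidence UNIV \<noteq> (0 :: real ^ 'e)" by (simp add: incidence_def vec_eq_iff)
  have "convex hull ?A \<subseteq> {x. c \<bullet> x \<le> 2}"
    by (rule hull_minimal) (use le in \<open>auto simp: convex_halfspace_le\<close>)
  then have "defines_facet (\<lambda>x. 2 * x $ e1 - xsum x (\<delta> S) + 2 * x $ e2) 2 (TECSP ends) \<longleftrightarrow>
      {x \<in> convex hull ?A. c \<bullet> x = 2} facet_of convex hull ?A"
    unfolding defines_facet_def TECSP_eq lhs by blast
  also have "\<dots> \<longleftrightarrow> ?A \<subseteq> span {x \<in> ?A. c \<bullet> x = 2}"
    by (rule facet_of_convex_hull_iff_span[OF _ A0 _ A1 A2 le]) auto
  also have "{x \<in> ?A. c \<bullet> x = 2} = incidence ` {F. tec F \<and> tight F}"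
    using tight by auto
  also have "?A \<subseteq> span (incidence ` {F. tec F \<and> tight F}) \<longleftrightarrow>
      (\<forall>z :: real ^ 'e. (\<forall>H. tec H \<longrightarrow> tight H \<longrightarrow> xsum z H = 0) \<longrightarrow> (\<forall>H. tec H \<longrightarrow> xsum z H = 0))"
    unfolding subset_span_iff_orthogonal by (simp add: inner_incidence imp_conjL)
  also have "\<dots> \<longleftrightarrow> tight_spans"
  proof
    assume L: "\<forall>z :: real ^ 'e. (\<forall>H. tec H \<longrightarrow> tight H \<longrightarrow> xsum z H = 0) \<longrightarrow> (\<forall>H. tec H \<longrightarrow> xsum z H = 0)"
    show tight_spans
      unfolding tight_spans_def
    proof
      fix w :: "'e \<Rightarrow> real"
      show "(\<forall>H. tec H \<longrightarrow> tight H \<longrightarrow> sum w H = 0) \<longrightarrow> (\<forall>H. tec H \<longrightarrow> sum w H = 0)"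
        using L[rule_format, of "vec_lambda w"] by (simp add: xsum_def)
    qed
  qed (simp add: tight_spans_def xsum_def)
  finally show ?thesis .
qed

end

section \<open>Two edges of the cut\<close>

lemma (in multigraph) cut_pairD:
  assumes "H \<inter> \<delta> Y = {a, b}" "e \<in> H"
  shows "e \<in> \<delta> Y \<longleftrightarrow> e = a \<or> e = b"
proof -
  have "e \<in> \<delta> Y \<longleftrightarrow> e \<in> H \<inter> \<delta> Y" using assms(2) by simp
  then show ?thesis unfolding assms(1) by simp
qed

lemma (in multigraph) cut_pair_in:
  assumes "H \<inter> \<delta> Y = {a, b}"
  shows "a \<in> H" "b \<in> H" "a \<in> \<delta> Y" "b \<in> \<delta> Y"
proof -
  have "{a, b} \<subseteq> H \<inter> \<delta> Y" unfolding assms ..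
  then show "a \<in> H" "b \<in> H" "a \<in> \<delta> Y" "b \<in> \<delta> Y" by auto
qed

text \<open>Assumption \<open>leg_in\<close> expresses \<open>card (delta_Wf ends S e1 e2 S f) = 1\<close>: the side of the bridge
  \<open>f\<close> away from \<open>e1\<close> carries a single edge \<open>g\<close> of the cut.\<close>

locale leg_graph = cut_graph ends S e1 e2
  for ends :: "'e::finite \<Rightarrow> 'v::finite set" and S e1 e2 +
  fixes w :: "'e \<Rightarrow> real"
  assumes e1_no_bridge: "e1 \<notin> bridges (induced_edges ends S)"
    and e2_no_bridge: "e2 \<notin> bridges (induced_edges ends (- S))"
    and leg_in: "\<And>f. f \<in> bridges (induced_edges ends S) \<Longrightarrow>
      \<exists>Y g. Y \<subseteq> S \<and> src e1 \<notin> Y \<and> tgt e1 \<notin> Y \<and> g \<in> cut ends S \<and> cut ends Y = {f, g}"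
    and leg_out: "\<And>f. f \<in> bridges (induced_edges ends (- S)) \<Longrightarrow>
      \<exists>Y g. Y \<subseteq> - S \<and> src e2 \<notin> Y \<and> tgt e2 \<notin> Y \<and> g \<in> cut ends S \<and> cut ends Y = {f, g}"
    and w_tight: "\<And>H. tec H \<Longrightarrow> tight H \<Longrightarrow> sum w H = 0"
begin

lemma leg_swap: "leg_graph ends (- S) e2 e1 w"
proof -
  interpret s: cut_graph ends "- S" e2 e1 by (rule swap)
  show ?thesis
    by unfold_locales
      (use e1_no_bridge e2_no_bridge leg_in leg_out w_tight in \<open>auto simp: cut_Compl tight_swap\<close>)
qed

abbreviation K :: "'e set" where
  "K \<equiv> core (E S) e1"

lemma e1_in: "e1 \<in> E S - bridges (E S)"
  using e1 e1_no_bridge by blast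

lemma tec_K: "tec K"
  by (rule core_tec[OF e1_in])

lemma e1_in_K: "e1 \<in> K"
  by (rule core_self[OF e1_in])

lemma K_subset: "K \<subseteq> E S" "K \<inter> bridges (E S) = {}"
  using core_subset[of "E S" e1] by auto

text \<open>\<open>K\<close> avoids the cut, so each of its \<open>tec\<close> subsets through
  \<open>e1\<close> is tight.\<close>

lemma K_class_zero: "d \<in> K \<Longrightarrow> sum w (cls K d) = 0"
proof (rule all_classes_zero[OF tec_K e1_in_K])
  fix H assume H: "tec H" "e1 \<in> H" "H \<subseteq> K"
  then have "H \<inter> \<delta> S = {}" using K_subset(1) E_disjoint by blast
  then have "tight H" unfolding tight_def using H by blast
  then show "sum w H = 0" using w_tight H by blast
qed

lemma K_zero: "sum w K = 0"
  by (rule sum_union_of_classes[OF tec_bridges[OF tec_K]])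
    (use K_class_zero cls_subset[OF tec_bridges[OF tec_K] subset_refl] in auto)

text \<open>The vertex set of \<open>K\<close>.\<close>

abbreviation Z :: "'v set" where
  "Z \<equiv> reach (E S - bridges (E S)) e1"

lemma Z_subset: "Z \<subseteq> S"
  by (rule reach_subset) (use E_disjoint ends_e1 in auto)

lemma in_K: "e \<in> K \<longleftrightarrow> e \<in> E S \<and> e \<notin> bridges (E S) \<and> src e \<in> Z \<and> tgt e \<in> Z"
  by (simp add: core_def in_block)

lemma bridge_series:
  assumes "b \<in> bridges (E S)"
  shows "\<exists>g\<in>\<delta> S. series UNIV b g"
proof -
  obtain Y g where "g \<in> \<delta> S" "\<delta> Y = {b, g}" using leg_in[OF assms] by blast
  then have "UNIV \<inter> \<delta> Y = {b, g}" by simp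
  then show ?thesis using \<open>g \<in> \<delta> S\<close> unfolding series_def by blast
qed

end

locale leg_pair = leg_graph ends S e1 e2 w
  for ends :: "'e::finite \<Rightarrow> 'v::finite set" and S e1 e2 w +
  fixes g h :: 'e
  assumes g: "g \<in> cut ends S" and h: "h \<in> cut ends S" and gh: "g \<noteq> h"
begin

lemma pair_swap: "leg_pair ends (- S) e2 e1 w g h"
proof -
  interpret s: leg_graph ends "- S" e2 e1 w by (rule leg_swap)
  show ?thesis by unfold_locales (use g h gh in \<open>auto simp: cut_Compl\<close>)
qed

lemma pair_sym: "leg_pair ends S e1 e2 w h g"
  by unfold_locales (use g h gh in auto)

abbreviation F :: "'e set" where
  "F \<equiv> - (\<delta> S - {g, h})"

abbreviation U :: "'e set" where
  "U \<equiv> core F g"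

lemma E_subset_F: "E S \<subseteq> F" "E (- S) \<subseteq> F"
  using E_disjoint by auto

lemma ends_g: "src g \<in> S \<longleftrightarrow> tgt g \<notin> S" and ends_h: "src h \<in> S \<longleftrightarrow> tgt h \<notin> S"
  using g h by (auto simp: in_cut)

text \<open>No edge inside either side leaves \<open>X\<close>, and both sides are connected; so
  \<open>X\<close> is empty, everything, \<open>S\<close> or \<open>- S\<close>.\<close>

lemma F_inner_closed:
  assumes "F \<inter> \<delta> X \<subseteq> {g, h}"
  shows "(S \<subseteq> X \<or> S \<inter> X = {}) \<and> (- S \<subseteq> X \<or> - S \<inter> X = {})"
proof -
  have "E S \<inter> \<delta> X = {}" "E (- S) \<inter> \<delta> X = {}"
    using assms E_subset_F E_disjoint g h by blast+
  then show ?thesis using connected_in connected_out by blast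
qed

lemma F_connected:
  assumes "F \<inter> \<delta> X = {}"
  shows "u \<in> X \<longleftrightarrow> v \<in> X"
proof -
  have 1: "(S \<subseteq> X \<or> S \<inter> X = {}) \<and> (- S \<subseteq> X \<or> - S \<inter> X = {})"
    by (rule F_inner_closed) (use assms in simp)
  moreover have "src g \<in> X \<longleftrightarrow> tgt g \<in> X" by (rule closedD[OF assms]) simp
  ultimately show ?thesis using ends_g by blast
qed

lemma F_cut_not_single: "F \<inter> \<delta> X \<noteq> {g}"
proof
  assume X: "F \<inter> \<delta> X = {g}"
  have 1: "(S \<subseteq> X \<or> S \<inter> X = {}) \<and> (- S \<subseteq> X \<or> - S \<inter> X = {})"
    by (rule F_inner_closed) (use X in simp)
  moreover have "src g \<in> X \<longleftrightarrow> tgt g \<notin> X" using X in_cut[of g X] by blast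
  ultimately have "src h \<in> X \<longleftrightarrow> tgt h \<notin> X" using ends_g ends_h by blast
  then have "h \<in> F \<inter> \<delta> X" by (simp add: in_cut)
  then have "h \<in> {g}" by (simp only: X)
  then show False using gh by simp
qed

lemma F_sym: "- (\<delta> S - {h, g}) = F"
  by auto

lemma F_cut_not_single': "F \<inter> \<delta> X \<noteq> {h}"
  using leg_pair.F_cut_not_single[OF pair_sym] unfolding F_sym .

lemma F_bridge_E: "b \<in> bridges F \<Longrightarrow> b \<in> E S \<Longrightarrow> b \<in> bridges (E S)"
  unfolding bridges_def using E_subset_F by blast

text \<open>The bridge \<open>b\<close> of \<open>F\<close> is one of \<open>G[S]\<close>, so its
  leg carries a single cut edge \<open>g'\<close>. If \<open>g'\<close> were still in
  \<open>F\<close>, combining the cut \<open>{b, g'}\<close> with a one-edge cut at \<open>b\<close>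
  would make \<open>g'\<close> a bridge of \<open>F\<close>. Hence \<open>g'\<close> was deleted,
  and neither \<open>g\<close> nor \<open>h\<close> is attached to the leg.\<close>

lemma F_bridge_inner:
  assumes b: "b \<in> bridges F" "b \<in> E S"
  shows "\<exists>Y g'. Y \<subseteq> S \<and> src e1 \<notin> Y \<and> tgt e1 \<notin> Y \<and> src g \<notin> Y \<and> src h \<notin> Y \<and>
    g' \<in> \<delta> S - {g, h} \<and> \<delta> Y = {b, g'} \<and> F \<inter> \<delta> Y = {b}"
proof -
  obtain Y g' where Y: "Y \<subseteq> S" "src e1 \<notin> Y" "tgt e1 \<notin> Y" "g' \<in> \<delta> S" "\<delta> Y = {b, g'}"
    using leg_in[OF F_bridge_E[OF b]] by blast
  obtain X where X: "F \<inter> \<delta> X = {b}" using b unfolding bridges_def by blast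
  have bS: "b \<notin> \<delta> S" using b E_disjoint by blast
  then have bF: "b \<in> F" by simp
  have g': "g' \<notin> {g, h}"
  proof
    assume "g' \<in> {g, h}"
    then have FY: "F \<inter> \<delta> Y = {b, g'}" "g' \<noteq> b" unfolding Y(5) using bS g h by auto
    have "F \<inter> \<delta> (X - Y \<union> (Y - X)) = {g'}"
      unfolding cut_sym_diff FY(1) X using FY(2) by auto
    then show False using \<open>g' \<in> {g, h}\<close> F_cut_not_single F_cut_not_single' by blast
  qed
  have "F \<inter> \<delta> Y = {b}" unfolding Y(5) using bF g' Y(4) by auto
  moreover have "g \<notin> \<delta> Y" "h \<notin> \<delta> Y" using g' bS g h unfolding Y(5) by auto
  then have "src g \<notin> Y" "src h \<notin> Y" using ends_g ends_h Y(1) by (auto simp: in_cut)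
  ultimately show ?thesis using Y g' by blast
qed

lemma F_bridge_cases: "b \<in> bridges F \<Longrightarrow> b \<in> E S \<or> b \<in> E (- S)"
  using edge_cases[of b] bridges_subset[of F] F_cut_not_single F_cut_not_single'
  unfolding bridges_def by blast

text \<open>Bridges of \<open>F\<close> do not separate \<open>g\<close>, \<open>e1\<close> and
  \<open>e2\<close> from each other, which places all three in \<open>U\<close>.\<close>

lemma F_bridge_cut:
  assumes b: "b \<in> bridges F"
  shows "\<exists>Y. F \<inter> \<delta> Y = {b} \<and> src g \<notin> Y \<and> src e1 \<notin> Y \<and> src e2 \<notin> Y"
proof (cases "b \<in> E S")
  case True
  then show ?thesis using F_bridge_inner[OF b] ends_e2 by blast
next
  case False
  interpret s: leg_pair ends "- S" e2 e1 w g h by (rule pair_swap)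
  have "b \<in> E (- S)" using F_bridge_cases[OF b] False by blast
  then show ?thesis using s.F_bridge_inner[unfolded cut_Compl, OF b] ends_e1 by blast
qed

lemma F_nonbridge: "g \<in> F - bridges F" "h \<in> F - bridges F" "e1 \<in> F - bridges F"
proof -
  have "g \<notin> bridges F" "h \<notin> bridges F"
    unfolding bridges_def using F_cut_not_single F_cut_not_single' by blast+
  moreover have "e1 \<notin> bridges F" using F_bridge_E e1 e1_no_bridge by blast
  moreover have "e1 \<in> F" using e1 E_subset_F by blast
  ultimately show "g \<in> F - bridges F" "h \<in> F - bridges F" "e1 \<in> F - bridges F" by auto
qed

lemma tec_U: "tec U"
  by (rule core_tec[OF F_nonbridge(1)])

lemmas bU = tec_bridges[OF tec_U]

lemma g_in_U: "g \<in> U"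
  by (rule core_self[OF F_nonbridge(1)])

lemma e1_in_U: "e1 \<in> U"
proof (rule in_coreI[OF F_nonbridge(3)])
  show "\<forall>b\<in>bridges F. \<exists>Y. F \<inter> \<delta> Y = {b} \<and> (src g \<in> Y \<longleftrightarrow> src e1 \<in> Y)"
  proof
    fix b assume "b \<in> bridges F"
    from F_bridge_cut[OF this] obtain Y where
      Y: "F \<inter> \<delta> Y = {b} \<and> src g \<notin> Y \<and> src e1 \<notin> Y \<and> src e2 \<notin> Y" ..
    then have "src g \<in> Y \<longleftrightarrow> src e1 \<in> Y" by simp
    with conjunct1[OF Y] have "F \<inter> \<delta> Y = {b} \<and> (src g \<in> Y \<longleftrightarrow> src e1 \<in> Y)" ..
    then show "\<exists>Y. F \<inter> \<delta> Y = {b} \<and> (src g \<in> Y \<longleftrightarrow> src e1 \<in> Y)" ..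
  qed
qed (rule F_connected)

lemma e2_in_U: "e2 \<in> U"
  using leg_pair.e1_in_U[OF pair_swap] unfolding cut_Compl .

lemma U_subset_F: "U \<subseteq> F"
  using core_subset by blast

lemma F_cut_S: "F \<inter> \<delta> S = {g, h}"
  using g h by auto

lemma h_in_U: "h \<in> U"
proof -
  have "series F g h" using F_cut_S unfolding series_def by blast
  then show ?thesis using series_subset(1)[OF bU U_subset_F g_in_U] by blast
qed

lemma U_cut_S: "U \<inter> \<delta> S = {g, h}"
  using U_subset_F F_cut_S g_in_U h_in_U by blast

lemma series_g_h: "series U g h"
  using U_cut_S unfolding series_def by blast

lemma U_tight: "tec H \<Longrightarrow> H \<subseteq> U \<Longrightarrow> e1 \<in> H \<Longrightarrow> e2 \<in> H \<Longrightarrow> sum w H = 0"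
proof -
  assume H: "tec H" "H \<subseteq> U" "e1 \<in> H" "e2 \<in> H"
  have "H \<inter> \<delta> S \<subseteq> {g, h}" using H(2) U_cut_S by blast
  then have "card (H \<inter> \<delta> S) \<le> card {g, h}" by (rule card_mono[rotated]) simp
  then have "card (H \<inter> \<delta> S) = 2" using card_cut_S_ge2[OF H(1,3,4)] gh by simp
  then show ?thesis using w_tight H unfolding tight_def by blast
qed

lemma K_subset_U: "K \<subseteq> U"
  by (rule tec_subset_core[OF tec_K _ e1_in_K e1_in_U]) (use K_subset E_subset_F in blast)

lemma bridge_series_U:
  assumes "b \<in> U" "b \<in> bridges (E S)"
  shows "b \<in> cls U g"
proof -
  obtain g' where g': "g' \<in> \<delta> S" "series UNIV b g'" using bridge_series assms by blast
  have 1: "g' \<in> U" "series U b g'" using series_subset[OF bU _ assms(1) g'(2)] by auto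
  then have "g' = g \<or> g' = h" using U_cut_S g' by blast
  then have "series U g g'" using series_g_h by auto
  then show ?thesis using 1 series_trans[OF bU] series_sym unfolding cls_def by blast
qed

lemma g_notin_K: "g \<notin> K"
  using K_subset E_disjoint g by blast

text \<open>An edge of \<open>U\<close> leaving \<open>Z\<close> is \<open>g\<close>,
  \<open>h\<close> or a bridge of \<open>G[S]\<close>. Such a bridge is in series in
  \<open>G\<close> with a cut edge, which then belongs to \<open>U\<close> and is \<open>g\<close>
  or \<open>h\<close>.\<close>

lemma Z_cut: "U \<inter> \<delta> Z \<subseteq> cls U g" and Z_cut_nonempty: "U \<inter> \<delta> Z \<noteq> {}"
proof -
  show "U \<inter> \<delta> Z \<subseteq> cls U g"
  proof
    fix e assume e: "e \<in> U \<inter> \<delta> Z"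
    show "e \<in> cls U g"
    proof (cases "e \<in> \<delta> S")
      case True
      then have "e = g \<or> e = h" using e U_cut_S by blast
      then show ?thesis using series_g_h by (auto simp: cls_def)
    next
      case False
      have "src e \<in> S \<or> tgt e \<in> S" using e Z_subset by (auto simp: in_cut)
      then have "e \<in> E S" using False by (auto simp: in_cut in_induced)
      moreover have "(E S - bridges (E S)) \<inter> \<delta> Z = {}" by (rule reach_closed)
      ultimately have "e \<in> bridges (E S)" using e by blast
      then show ?thesis using bridge_series_U e by blast
    qed
  qed
  show "U \<inter> \<delta> Z \<noteq> {}"
    using tec_not_separated[OF tec_U _ e1_in_U e2_in_U, of Z] ends_reach ends_e2 Z_subset by blast
qed

text \<open>Both \<open>K\<close> and the class of \<open>g\<close> survive the deletion. Some edge
  of that class leaves \<open>Z\<close>, so it lies in the component of \<open>e1\<close> and brings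
  \<open>g\<close> along by series.\<close>

lemma g_in_block:
  assumes d: "d \<in> U" "cls U d \<inter> K = {}" "g \<notin> cls U d"
  shows "g \<in> block (U - cls U d) e1"
proof -
  let ?D = "cls U d"
  let ?B = "block (U - ?D) e1"
  have e1D: "e1 \<in> U - ?D" using e1_in_U e1_in_K d by blast
  have tB: "tec ?B" by (rule block_tec[OF bridgeless_Diff_cls[OF bU] e1D])
  have KB: "K \<subseteq> ?B"
    by (rule tec_subset_block[OF tec_K _ e1_in_K block_self[OF e1D]]) (use K_subset_U d in blast)
  have "K \<inter> \<delta> (reach (U - ?D) e1) = {}"
    using KB reach_closed[of "U - ?D" e1] block_subset by blast
  then have ZB: "Z \<subseteq> reach (U - ?D) e1"
    unfolding core_def by (rule reach_subset_block) (rule ends_reach)+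
  obtain c where c: "c \<in> U" "c \<in> \<delta> Z" using Z_cut_nonempty by blast
  then have cg: "c \<in> cls U g" using Z_cut by blast
  have "c \<notin> ?D"
    using cg d(3) series_trans[OF bU] series_sym unfolding cls_def by blast
  then have "src c \<in> reach (U - ?D) e1 \<longleftrightarrow> tgt c \<in> reach (U - ?D) e1"
    using closedD[OF reach_closed[of "U - ?D" e1], of c] c by blast
  moreover have "src c \<in> Z \<or> tgt c \<in> Z" using c(2) by (auto simp: in_cut)
  ultimately have "c \<in> ?B" using ZB c(1) \<open>c \<notin> ?D\<close> unfolding in_block by blast
  moreover have "series U c g" using cg series_sym unfolding cls_def by blast
  ultimately show ?thesis
    using series_subset(1)[OF tec_bridges[OF tB]] block_subset[of "U - ?D" e1] by blast
qed

lemma g_in_block':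
  assumes "d \<in> U" "cls U d \<inter> core (E (- S)) e2 = {}" "g \<notin> cls U d"
  shows "g \<in> block (U - cls U d) e2"
  using leg_pair.g_in_block[OF pair_swap, unfolded cut_Compl, OF assms] .

lemma K'_facts: "core (E (- S)) e2 \<subseteq> U" "core (E (- S)) e2 \<subseteq> E (- S)" "tec (core (E (- S)) e2)"
    "sum w (core (E (- S)) e2) = 0" "e2 \<in> core (E (- S)) e2"
proof -
  interpret s: leg_pair ends "- S" e2 e1 w g h by (rule pair_swap)
  show "core (E (- S)) e2 \<subseteq> U" "core (E (- S)) e2 \<subseteq> E (- S)" "tec (core (E (- S)) e2)"
    "sum w (core (E (- S)) e2) = 0" "e2 \<in> core (E (- S)) e2"
    using s.K_subset_U s.K_subset s.tec_K s.K_zero s.e1_in_K by (simp_all add: cut_Compl)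
qed

lemma K_disjoint: "K \<inter> core (E (- S)) e2 = {}"
  using K_subset K'_facts E_disjoint by blast

text \<open>After the deletion \<open>g\<close> is still connected to \<open>e1\<close> and to
  \<open>e2\<close>, so the class is removable with \<open>R = {e1, e2}\<close>.\<close>

lemma outer_class_zero:
  assumes d: "d \<in> U" "cls U d \<inter> K = {}" "cls U d \<inter> core (E (- S)) e2 = {}" "g \<notin> cls U d"
  shows "sum w (cls U d) = 0"
proof (rule removable_class_zero[OF tec_U, of e1 "{e1, e2}"])
  have e: "e1 \<in> U - cls U d" "e2 \<in> U - cls U d"
    using e1_in_U e2_in_U e1_in_K K'_facts d by blast+
  have "e2 \<in> block (U - cls U d) g"
    by (rule block_sym[OF g_in_block'[OF d(1,3,4)] e(2)])
  then have "e2 \<in> block (U - cls U d) e1"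
    using g_in_block[OF d(1,2,4)] by (rule block_trans)
  then show "{e1, e2} \<subseteq> block (U - cls U d) e1"
    using block_self[OF e(1)] by blast
qed (use d U_tight in auto)

text \<open>The class of \<open>g\<close> is what remains of \<open>U\<close> after removing
  \<open>K\<close>, \<open>?K'\<close> and the classes outside them, all of weight 0.\<close>

lemma class_of_g_zero: "sum w (cls U g) = 0"
proof -
  let ?K' = "core (E (- S)) e2"
  let ?R = "U - cls U g - K - ?K'"
  have gU: "cls U g \<subseteq> U" by (rule cls_subset[OF bU subset_refl g_in_U])
  have sub: "cls U d \<inter> K = {} \<and> cls U d \<inter> ?K' = {} \<and> cls U d \<subseteq> U - cls U g"
    if d: "d \<in> ?R" for d
  proof (intro conjI)
    show "cls U d \<subseteq> U - cls U g"
      using cls_subset[OF bU subset_refl, of d] d series_trans[OF bU] series_sym unfolding cls_def by blast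
    show "cls U d \<inter> K = {}"
      using series_subset(1)[OF tec_bridges[OF tec_K] K_subset_U _ series_sym] d unfolding cls_def by blast
    show "cls U d \<inter> ?K' = {}"
      using series_subset(1)[OF tec_bridges[OF K'_facts(3)] K'_facts(1) _ series_sym] d
      unfolding cls_def by blast
  qed
  have R: "sum w ?R = 0"
  proof (rule sum_union_of_classes[OF bU])
    fix d assume d: "d \<in> ?R"
    show "cls U d \<subseteq> ?R" using sub[OF d] by blast
    have "g \<in> cls U g" by (simp add: cls_def)
    then show "sum w (cls U d) = 0" using outer_class_zero[of d] sub[OF d] d by blast
  qed
  have gK: "cls U g \<inter> K = {}" "cls U g \<inter> ?K' = {}"
    using series_subset(1)[OF tec_bridges[OF tec_K] K_subset_U _ series_sym] g_notin_K
      series_subset(1)[OF tec_bridges[OF K'_facts(3)] K'_facts(1) _ series_sym] K'_facts(2) E_disjoint g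
    unfolding cls_def by blast+
  have "K \<inter> (?K' \<union> cls U g) = {}" "?K' \<inter> cls U g = {}"
    using gK K_disjoint by blast+
  then have "sum w (K \<union> (?K' \<union> cls U g)) = sum w K + (sum w ?K' + sum w (cls U g))"
    by (simp only: sum.union_disjoint finite)
  moreover have "U - (K \<union> (?K' \<union> cls U g)) = ?R" by blast
  moreover have "sum w U = sum w (U - (K \<union> (?K' \<union> cls U g))) + sum w (K \<union> (?K' \<union> cls U g))"
    by (rule sum.subset_diff) (use gU K_subset_U K'_facts(1) in simp_all)
  moreover have "sum w U = 0" using U_tight tec_U e1_in_U e2_in_U by blast
  ultimately show ?thesis using R K_zero K'_facts(4) by (simp only:)
qed

section \<open>Series classes of \<open>U\<close> inside \<open>K\<close>\<close>

lemma K_class_subset: "d \<in> K \<Longrightarrow> cls U d \<subseteq> K"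
  by (rule cls_subset[OF tec_bridges[OF tec_K] K_subset_U])

lemma series_U_K: "series U c d \<Longrightarrow> c \<in> K \<Longrightarrow> series K c d"
  by (rule series_subset(2)[OF tec_bridges[OF tec_K] K_subset_U])

lemma good_class_zero:
  assumes "d \<in> K" "e1 \<in> block (U - cls U d) e2"
  shows "sum w (cls U d) = 0"
proof (rule removable_class_zero[OF tec_U, of e2 "{e1, e2}"])
  have "e2 \<in> U - cls U d" using e2_in_U K_class_subset[OF assms(1)] K_disjoint K'_facts(5) by blast
  then show "{e1, e2} \<subseteq> block (U - cls U d) e2" using block_self assms by blast
qed (use assms K_subset_U U_tight in auto)

text \<open>Only classes \<open>D\<close> of \<open>U\<close> inside \<open>K\<close> that cut \<open>e1\<close> off from \<open>e2\<close> are not covered by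
  \<open>removable_class_zero\<close>. Each series class of \<open>K\<close>, which has weight 0, contains at most one
  of them.\<close>

lemma bad_class_cut:
  assumes d: "d \<in> K" and e1d: "e1 \<notin> cls U d" and bad: "e1 \<notin> block (U - cls U d) e2"
  shows "\<exists>Y d1 d2. d1 \<in> cls U d \<and> d2 \<in> cls U d \<and> U \<inter> \<delta> Y = {d1, d2} \<and> src e1 \<in> Y \<and> tgt e1 \<in> Y \<and>
    (\<forall>e\<in>U. src e \<in> Y \<or> tgt e \<in> Y \<longrightarrow> e \<in> K)"
proof -
  let ?D = "cls U d"
  let ?X = "reach (U - ?D) e2"
  let ?B = "block (U - ?D) e2"
  have DK: "?D \<subseteq> K" by (rule K_class_subset[OF d])
  have X: "(U - ?D) \<inter> \<delta> ?X = {}" by (rule reach_closed)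
  have e1X: "src e1 \<notin> ?X"
    using bad closedD[OF X, of e1] e1_in_U e1d unfolding in_block by blast
  have e2X: "src e2 \<in> ?X" by (rule ends_reach)
  \<comment> \<open>Otherwise \<open>parity_pairs\<close> turns \<open>?X\<close> into a set that
    still separates \<open>e1\<close> from \<open>e2\<close> but is left by at most one edge of
    \<open>U\<close>, impossible in a 2-edge-connected set.\<close>
  have "\<exists>d1\<in>?D. \<exists>d2\<in>?D. d1 \<noteq> d2 \<and> (\<forall>Y. U \<inter> \<delta> Y = {d1, d2} \<longrightarrow> (src e1 \<in> Y) \<noteq> (src e2 \<in> Y))"
  proof (rule ccontr)
    assume "\<not> ?thesis"
    then have "\<forall>d1\<in>?D. \<forall>d2\<in>?D. d1 \<noteq> d2 \<longrightarrow> (\<exists>Y. U \<inter> \<delta> Y = {d1, d2} \<and> (src e1 \<in> Y \<longleftrightarrow> src e2 \<in> Y))"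
      by blast
    from parity_pairs[OF this, of ?X] obtain X' where
      X': "U \<inter> \<delta> X' - ?D = U \<inter> \<delta> ?X - ?D" "card (U \<inter> \<delta> X' \<inter> ?D) \<le> 1"
        "(src e1 \<in> X' \<longleftrightarrow> src e2 \<in> X') \<longleftrightarrow> (src e1 \<in> ?X \<longleftrightarrow> src e2 \<in> ?X)" by blast
    have "U \<inter> \<delta> X' \<inter> ?D = U \<inter> \<delta> X'" using X X'(1) by blast
    then have "card (U \<inter> \<delta> X') \<le> 1" using X'(2) by simp
    moreover have "card (U \<inter> \<delta> X') \<noteq> 1"
      using cut_not_single[OF bU] by (metis card_1_singletonE)
    ultimately have "card (U \<inter> \<delta> X') = 0" by linarith
    then have "U \<inter> \<delta> X' = {}" by simp
    then have "src e1 \<in> X' \<longleftrightarrow> src e2 \<in> X'"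
      using tec_not_separated[OF tec_U] e1_in_U e2_in_U by blast
    then show False using X'(3) e1X e2X by blast
  qed
  then obtain d1 d2 where d12: "d1 \<in> ?D" "d2 \<in> ?D" "d1 \<noteq> d2"
    and sep: "\<And>Y. U \<inter> \<delta> Y = {d1, d2} \<Longrightarrow> (src e1 \<in> Y) \<noteq> (src e2 \<in> Y)" by blast
  have "series U d1 d2" using d12 series_trans[OF bU] series_sym unfolding cls_def by blast
  then obtain Y' where Y': "U \<inter> \<delta> Y' = {d1, d2}" using d12(3) unfolding series_def by blast
  define Y0 where "Y0 = (if src e1 \<in> Y' then Y' else - Y')"
  have Y0: "U \<inter> \<delta> Y0 = {d1, d2}" using Y' by (simp add: Y0_def cut_Compl)
  have s1: "src e1 \<in> Y0" and s2: "src e2 \<notin> Y0" using sep[OF Y'] by (auto simp: Y0_def)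
  have "e1 \<notin> \<delta> Y0" using cut_pairD[OF Y0 e1_in_U] e1d d12 by blast
  then have t1: "tgt e1 \<in> Y0" using s1 by (simp add: in_cut)
  have e2D: "e2 \<in> U - ?D" using e2_in_U DK K_disjoint K'_facts(5) by blast
  have tB: "tec ?B" by (rule block_tec[OF bridgeless_Diff_cls[OF bU] e2D])
  have "g \<in> ?B"
    by (rule g_in_block') (use d K_subset_U DK K_disjoint g_notin_K in blast)+
  then have gB: "cls U g \<subseteq> ?B"
    by (intro cls_subset[OF tec_bridges[OF tB]]) (use block_subset in blast)
  have "?B \<inter> \<delta> Y0 = {}" using block_subset[of "U - ?D" e2] cut_pairD[OF Y0] d12 by blast
  then have Bout: "src e \<notin> Y0 \<and> tgt e \<notin> Y0" if "e \<in> ?B" for e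
    using tec_not_separated[OF tB _ that block_self[OF e2D]] s2 by blast
  \<comment> \<open>Restricting to \<open>Z\<close> forces every edge of \<open>U\<close> touching
    the set into \<open>K\<close>. The cut stays the same, because edges of \<open>U\<close> leaving
    \<open>Z\<close> lie in the class of \<open>g\<close>, hence in \<open>?B\<close>, which misses
    \<open>Y0\<close>.\<close>
  let ?Y = "Y0 \<inter> Z"
  have Zcl: "src e \<in> Z \<longleftrightarrow> tgt e \<in> Z" if "e \<in> U" "e \<notin> ?B" for e
    using that gB Z_cut in_cut[of e Z] by blast
  have d12Z: "src e \<in> Z \<and> tgt e \<in> Z" if "e \<in> ?D" for e
    using that DK in_K by blast
  have "U \<inter> \<delta> ?Y = {d1, d2}"
  proof (intro equalityI subsetI)
    fix e assume e: "e \<in> U \<inter> \<delta> ?Y"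
    then have "e \<notin> ?B" using Bout[of e] in_cut[of e ?Y] by blast
    then have "e \<in> U" "e \<in> \<delta> Y0" using e Zcl[of e] by (auto simp: in_cut)
    then show "e \<in> {d1, d2}" using cut_pairD[OF Y0] by blast
  next
    fix e assume e: "e \<in> {d1, d2}"
    then have "e \<in> U" "e \<in> \<delta> Y0" "e \<in> ?D" using cut_pair_in[OF Y0] d12 by auto
    then show "e \<in> U \<inter> \<delta> ?Y" using d12Z[of e] by (simp add: in_cut)
  qed
  moreover have "src e1 \<in> ?Y" "tgt e1 \<in> ?Y" using s1 t1 ends_reach by blast+
  moreover have "e \<in> K" if e: "e \<in> U" "src e \<in> ?Y \<or> tgt e \<in> ?Y" for e
  proof -
    have eB: "e \<notin> ?B" using Bout[of e] e by blast
    then have z: "src e \<in> Z" "tgt e \<in> Z" using Zcl[of e] e by blast+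
    then have "e \<in> E S" using Z_subset in_induced by blast
    moreover have "e \<notin> bridges (E S)" using bridge_series_U e eB gB by blast
    ultimately show ?thesis using z in_K by blast
  qed
  ultimately show ?thesis using d12 by blast
qed

text \<open>A cut \<open>W\<close> of \<open>K\<close> with edges \<open>c\<close>,
  \<open>d1\<close> splits \<open>Y\<close> into two parts. If \<open>c\<close> is inside
  \<open>Y\<close>, it leaves both parts, while \<open>d1\<close> and \<open>d2\<close> leave
  exactly one each. Then a part is left by \<open>c\<close> alone, or by \<open>c\<close> and one of
  \<open>d1\<close>, \<open>d2\<close>: a bridge of \<open>U\<close>, or a series relation that is
  excluded.\<close>

lemma no_inner_series:
  assumes d12: "d1 \<in> cls U d" "d2 \<in> cls U d" and Y: "U \<inter> \<delta> Y = {d1, d2}"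
    and YK: "\<And>e. e \<in> U \<Longrightarrow> src e \<in> Y \<or> tgt e \<in> Y \<Longrightarrow> e \<in> K"
    and c: "c \<in> K" "series K c d1" "c \<notin> cls U d"
  shows "\<not> (src c \<in> Y \<and> tgt c \<in> Y)"
proof
  assume cY: "src c \<in> Y \<and> tgt c \<in> Y"
  have cU: "c \<in> U" using c K_subset_U by blast
  have cd: "c \<noteq> d1" "c \<noteq> d2" using c d12 by auto
  then obtain W where W: "K \<inter> \<delta> W = {c, d1}" using c(2) unfolding series_def by blast
  have ns: "\<not> series U c d1" "\<not> series U c d2"
    using c(3) d12 series_trans[OF bU] series_sym unfolding cls_def by blast+
  let ?A = "Y \<inter> W" and ?B = "Y - W"
  have sub: "U \<inter> \<delta> Q \<subseteq> {c, d1, d2}" if "Q = ?A \<or> Q = ?B" for Q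
  proof
    fix e assume e: "e \<in> U \<inter> \<delta> Q"
    then have "src e \<in> Y \<or> tgt e \<in> Y" using that by (auto simp: in_cut)
    then have "e \<in> K" using YK e by blast
    moreover have "e \<in> \<delta> Y \<or> e \<in> \<delta> W" using e that cut_Int_subset cut_Diff_subset by blast
    ultimately show "e \<in> {c, d1, d2}" using e cut_pairD[OF Y] cut_pairD[OF W] by blast
  qed
  have "c \<in> \<delta> W" by (rule cut_pair_in[OF W])
  then have cAB: "c \<in> \<delta> ?A" "c \<in> \<delta> ?B" using cY by (auto simp: in_cut)
  have dY: "d1 \<in> \<delta> Y" "d2 \<in> \<delta> Y" and dU: "d1 \<in> U" "d2 \<in> U"
    using cut_pair_in[OF Y] by blast+
  have ex: "e \<in> \<delta> ?A \<longleftrightarrow> e \<notin> \<delta> ?B" if "e \<in> \<delta> Y" for e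
    using that by (auto simp: in_cut)
  show False
  proof (cases "d1 \<in> \<delta> ?A"; cases "d2 \<in> \<delta> ?A")
    assume "d1 \<in> \<delta> ?A" "d2 \<in> \<delta> ?A"
    then have "d1 \<notin> \<delta> ?B" "d2 \<notin> \<delta> ?B" using ex dY by blast+
    then have "U \<inter> \<delta> ?B = {c}" using sub[of ?B] cU cAB by auto
    then show False using cut_not_single[OF bU] by blast
  next
    assume "d1 \<notin> \<delta> ?A" "d2 \<notin> \<delta> ?A"
    then have "U \<inter> \<delta> ?A = {c}" using sub[of ?A] cU cAB by auto
    then show False using cut_not_single[OF bU] by blast
  next
    assume "d1 \<in> \<delta> ?A" "d2 \<notin> \<delta> ?A"
    then have "U \<inter> \<delta> ?A = {c, d1}" using sub[of ?A] cU cAB dU by auto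
    then show False using ns unfolding series_def by blast
  next
    assume "d1 \<notin> \<delta> ?A" "d2 \<in> \<delta> ?A"
    then have "U \<inter> \<delta> ?A = {c, d2}" using sub[of ?A] cU cAB dU by auto
    then show False using ns unfolding series_def by blast
  qed
qed

text \<open>Each of two different bad classes has a cut set around \<open>e1\<close> with no edge of
  the other class inside. If \<open>e1\<close> belongs to one class, it lies inside the set of the
  other. If it belongs to neither, no edge of \<open>U\<close> leaves \<open>Y \<inter> Y'\<close>,
  which then contains an end of \<open>e2\<close>, although edges of \<open>U\<close> touching
  \<open>Y\<close> lie in \<open>K\<close>.\<close>

lemma bad_classes_equal:
  assumes d: "d \<in> K" "d' \<in> K" "series K d d'"
    and bad: "e1 \<notin> block (U - cls U d) e2" "e1 \<notin> block (U - cls U d') e2"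
  shows "series U d d'"
proof (rule ccontr)
  assume ns: "\<not> series U d d'"
  note bK = tec_bridges[OF tec_K]
  have disj: "cls U d \<inter> cls U d' = {}"
    using ns series_trans[OF bU] series_sym unfolding cls_def by blast
  have serK: "series K c c'"
    if "c \<in> cls U d \<or> c \<in> cls U d'" "c' \<in> cls U d \<or> c' \<in> cls U d'" for c c'
  proof -
    have "series K d x" if "x \<in> cls U d \<or> x \<in> cls U d'" for x
      using that series_U_K d series_trans[OF bK] unfolding cls_def by blast
    then show ?thesis using that series_trans[OF bK] series_sym by blast
  qed
  have inner: "\<exists>Y. (\<exists>d1 d2. d1 \<in> cls U c \<and> d2 \<in> cls U c \<and> U \<inter> \<delta> Y = {d1, d2}) \<and> src e1 \<in> Y \<and> tgt e1 \<in> Y \<and>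
      (\<forall>e\<in>U. src e \<in> Y \<or> tgt e \<in> Y \<longrightarrow> e \<in> K) \<and> (\<forall>x\<in>cls U c'. \<not> (src x \<in> Y \<and> tgt x \<in> Y))"
    if c: "c = d \<and> c' = d' \<or> c = d' \<and> c' = d" and e1c: "e1 \<notin> cls U c" for c c'
  proof -
    have cK: "c \<in> K" "c' \<in> K" "e1 \<notin> block (U - cls U c) e2" using c d bad by auto
    obtain Y d1 d2 where Y: "d1 \<in> cls U c" "d2 \<in> cls U c" "U \<inter> \<delta> Y = {d1, d2}" "src e1 \<in> Y" "tgt e1 \<in> Y"
      and YK: "\<And>e. e \<in> U \<Longrightarrow> src e \<in> Y \<or> tgt e \<in> Y \<Longrightarrow> e \<in> K"
      using bad_class_cut[OF cK(1) e1c cK(3)] by blast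
    have "\<not> (src x \<in> Y \<and> tgt x \<in> Y)" if x: "x \<in> cls U c'" for x
    proof (rule no_inner_series[OF Y(1-3) YK])
      show "x \<in> K" using x K_class_subset cK by blast
      show "series K x d1" using serK x Y(1) c by blast
      show "x \<notin> cls U c" using disj x c by blast
    qed auto
    then show ?thesis using Y YK by blast
  qed
  show False
  proof (cases "e1 \<in> cls U d \<or> e1 \<in> cls U d'")
    case True
    then show False using inner[of d d'] inner[of d' d] disj by blast
  next
    case False
    obtain Y d1 d2 where Y: "d1 \<in> cls U d" "d2 \<in> cls U d" "U \<inter> \<delta> Y = {d1, d2}" "src e1 \<in> Y" "tgt e1 \<in> Y"
      "\<And>e. e \<in> U \<Longrightarrow> src e \<in> Y \<or> tgt e \<in> Y \<Longrightarrow> e \<in> K"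
      "\<And>x. x \<in> cls U d' \<Longrightarrow> \<not> (src x \<in> Y \<and> tgt x \<in> Y)"
      using inner[of d d'] False by blast
    obtain Y' d1' d2' where Y': "d1' \<in> cls U d'" "d2' \<in> cls U d'" "U \<inter> \<delta> Y' = {d1', d2'}"
      "src e1 \<in> Y'" "tgt e1 \<in> Y'"
      "\<And>x. x \<in> cls U d \<Longrightarrow> \<not> (src x \<in> Y' \<and> tgt x \<in> Y')"
      using inner[of d' d] False by blast
    have "e \<notin> \<delta> (Y \<inter> Y')" if e: "e \<in> U" for e
    proof
      assume eYY: "e \<in> \<delta> (Y \<inter> Y')"
      then consider "e \<in> \<delta> Y" | "e \<in> \<delta> Y'" using cut_Int_subset by blast
      then show False
      proof cases
        case 1
        then have "e \<in> cls U d" using cut_pairD[OF Y(3) e] Y(1,2) by blast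
        then have "e \<notin> \<delta> Y'" "\<not> (src e \<in> Y' \<and> tgt e \<in> Y')"
          using cut_pairD[OF Y'(3) e] Y' disj by blast+
        then show False using eYY by (auto simp: in_cut)
      next
        case 2
        then have "e \<in> cls U d'" using cut_pairD[OF Y'(3) e] Y'(1,2) by blast
        then have "e \<notin> \<delta> Y" "\<not> (src e \<in> Y \<and> tgt e \<in> Y)"
          using cut_pairD[OF Y(3) e] Y disj by blast+
        then show False using eYY by (auto simp: in_cut)
      qed
    qed
    then have "U \<inter> \<delta> (Y \<inter> Y') = {}" by blast
    then have "src e2 \<in> Y \<inter> Y'"
      using tec_not_separated[OF tec_U _ e1_in_U e2_in_U] Y(4) Y'(4) by blast
    then have "e2 \<in> K" using Y(6) e2_in_U by blast
    then show False using K_disjoint K'_facts(5) by blast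
  qed
qed

text \<open>The class of \<open>d\<close> in \<open>K\<close> is a union of classes of
  \<open>U\<close>. If that of \<open>d\<close> is bad, the others are good and have weight 0, as
  does the total.\<close>

lemma inner_class_zero:
  assumes d: "d \<in> K"
  shows "sum w (cls U d) = 0"
proof (cases "e1 \<in> block (U - cls U d) e2")
  case True
  then show ?thesis using good_class_zero d by blast
next
  case False
  note bK = tec_bridges[OF tec_K]
  have UK: "cls U c \<subseteq> cls K d" if "c \<in> K" "series K d c" for c
    using that series_U_K series_trans[OF bK] unfolding cls_def by blast
  have CK: "cls K d \<subseteq> K" by (rule cls_subset[OF bK subset_refl d])
  have "sum w (cls K d - cls U d) = 0"
  proof (rule sum_union_of_classes[OF bU])
    fix c assume c: "c \<in> cls K d - cls U d"
    then have cK: "c \<in> K" "series K d c" using CK unfolding cls_def by blast+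
    show "cls U c \<subseteq> cls K d - cls U d"
      using UK[OF cK] c series_trans[OF bU] series_sym unfolding cls_def by blast
    have "e1 \<in> block (U - cls U c) e2"
    proof (rule ccontr)
      assume "e1 \<notin> block (U - cls U c) e2"
      then have "series U d c" using bad_classes_equal[OF d cK False] by blast
      then show False using c unfolding cls_def by blast
    qed
    then show "sum w (cls U c) = 0" using good_class_zero cK by blast
  qed
  moreover have "sum w (cls K d) = sum w (cls K d - cls U d) + sum w (cls U d)"
    using UK[OF d] by (simp add: sum.subset_diff)
  ultimately show ?thesis using K_class_zero[OF d] by simp
qed

lemma U_class_zero:
  assumes d: "d \<in> U"
  shows "sum w (cls U d) = 0"
proof -
  let ?K' = "core (E (- S)) e2"
  consider "d \<in> K" | "d \<in> ?K'" | "series U g d" | "d \<notin> K" "d \<notin> ?K'" "\<not> series U g d" by blast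
  then show ?thesis
  proof cases
    case 1
    then show ?thesis by (rule inner_class_zero)
  next
    case 2
    then show ?thesis using leg_pair.inner_class_zero[OF pair_swap] by (simp add: cut_Compl)
  next
    case 3
    then show ?thesis using class_of_g_zero cls_eq[OF bU] by metis
  next
    case 4
    have "cls U d \<inter> K = {}"
      using series_subset(1)[OF tec_bridges[OF tec_K] K_subset_U _ series_sym] 4 unfolding cls_def by blast
    moreover have "cls U d \<inter> ?K' = {}"
      using series_subset(1)[OF tec_bridges[OF K'_facts(3)] K'_facts(1) _ series_sym] 4
      unfolding cls_def by blast
    moreover have "g \<notin> cls U d" using 4 series_sym unfolding cls_def by blast
    ultimately show ?thesis using outer_class_zero d by blast
  qed
qed

end

section \<open>Series classes of the whole graph\<close>

lemma ex_extremal_pair: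
  fixes T :: "'a \<Rightarrow> 'b::finite set"
  assumes "finite A" "card A \<ge> 2"
    and chain: "\<And>x y. x \<in> A \<Longrightarrow> y \<in> A \<Longrightarrow> T x \<subseteq> T y \<or> T y \<subseteq> T x"
  shows "\<exists>g\<in>A. \<exists>h\<in>A. g \<noteq> h \<and> (\<forall>x\<in>A. T g \<subseteq> T x \<and> T x \<subseteq> T h)"
proof -
  let ?N = "(\<lambda>x. card (T x)) ` A"
  have ne: "finite ?N" "?N \<noteq> {}" using assms by auto
  obtain g where g: "g \<in> A" "card (T g) = Min ?N" using Min_in[OF ne] by auto
  obtain h where h: "h \<in> A" "card (T h) = Max ?N" using Max_in[OF ne] by auto
  have sub: "T x \<subseteq> T y" if "x \<in> A" "y \<in> A" "card (T x) \<le> card (T y)" for x y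
    using chain[OF that(1,2)] that(3) card_seteq[of "T x" "T y"] by auto
  have le: "T g \<subseteq> T x" "T x \<subseteq> T h" if x: "x \<in> A" for x
  proof -
    have "card (T x) \<in> ?N" using x by blast
    then have "card (T g) \<le> card (T x)" "card (T x) \<le> card (T h)"
      unfolding g(2) h(2) using ne by simp_all
    then show "T g \<subseteq> T x" "T x \<subseteq> T h" using sub x g(1) h(1) by blast+
  qed
  show ?thesis
  proof (cases "g = h")
    \<comment> \<open>Minimum and maximum at the same element mean that all sets agree, so any
      second element serves.\<close>
    case True
    obtain h' where "h' \<in> A" "h' \<noteq> g"
      using assms(2) g(1) card_le_Suc0_iff_eq[OF assms(1)] by (metis not_less_eq_eq numeral_2_eq_2)
    then show ?thesis using True g h le by blast
  qed (use g h le in blast)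
qed

context leg_pair
begin

section \<open>Lifting series relations from \<open>U\<close> to \<open>G\<close>\<close>

lemma UNIV_class_zero:
  assumes "d \<in> U" "\<And>c. series U d c \<Longrightarrow> series UNIV d c"
  shows "sum w (cls UNIV d) = 0"
proof -
  have "cls UNIV d = cls U d"
    unfolding cls_def using assms(2) series_subset(2)[OF bU _ assms(1)] by blast
  then show ?thesis using U_class_zero[OF assms(1)] by simp
qed

lemma series_lift:
  assumes "series U d c" "d \<noteq> c"
  shows "\<exists>X. F \<inter> \<delta> X = {d, c}"
proof -
  obtain X where "U \<inter> \<delta> X = {d, c}" using assms unfolding series_def by blast
  then show ?thesis by (rule core_cut_lift)
qed

text \<open>In the lifted 2-edge cut, \<open>c\<close> must lie in \<open>G[S]\<close>, or
  \<open>d\<close> would be a bridge there. Then no edge inside \<open>- S\<close> crosses, so one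
  of \<open>X\<close>, \<open>- X\<close> lies in \<open>S\<close>.\<close>

lemma inner_cut_lift:
  assumes d: "d \<in> E S - bridges (E S)" and c: "series U d c" "d \<noteq> c"
  shows "\<exists>X. X \<subseteq> S \<and> E S \<inter> \<delta> X = {d, c} \<and> g \<notin> \<delta> X \<and> h \<notin> \<delta> X"
proof -
  obtain X where X: "F \<inter> \<delta> X = {d, c}" using series_lift[OF c] by blast
  have cS: "c \<in> E S"
  proof (rule ccontr)
    assume "c \<notin> E S"
    then have "E S \<inter> \<delta> X = {d}"
      using cut_pairD[OF X subsetD[OF E_subset_F(1)]] d by auto
    then show False using d unfolding bridges_def by blast
  qed
  have dS: "d \<in> E S" using d by simp
  then have outer: "d \<notin> E (- S)" "c \<notin> E (- S)" "g \<noteq> d" "g \<noteq> c" "h \<noteq> d" "h \<noteq> c"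
    using cS E_disjoint g h by blast+
  have "e \<notin> \<delta> X" if "e \<in> E (- S)" for e
    using cut_pairD[OF X subsetD[OF E_subset_F(2) that]] that outer(1,2) by auto
  then have "E (- S) \<inter> \<delta> X = {}" by blast
  then have out: "- S \<subseteq> X \<or> - S \<inter> X = {}" by (rule connected_out)
  define X' where "X' = (if - S \<inter> X = {} then X else - X)"
  have dX: "\<delta> X' = \<delta> X" by (simp add: X'_def cut_Compl)
  have "X' \<subseteq> S" using out by (auto simp: X'_def)
  moreover have "E S \<inter> \<delta> X' = {d, c}"
    unfolding dX using cut_pairD[OF X subsetD[OF E_subset_F(1)]] dS cS by auto
  moreover have "g \<notin> \<delta> X'" "h \<notin> \<delta> X'"
    unfolding dX using cut_pairD[OF X, of g] cut_pairD[OF X, of h] outer by simp_all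
  ultimately show ?thesis by blast
qed

lemma not_series_UNIV:
  assumes "card (\<delta> S) \<ge> 3"
  shows "\<not> series UNIV g h"
proof
  assume "series UNIV g h"
  then obtain X where "UNIV \<inter> \<delta> X = {g, h}" using gh unfolding series_def by blast
  then have X: "\<delta> X = {g, h}" by simp
  have "(S \<subseteq> X \<or> S \<inter> X = {}) \<and> (- S \<subseteq> X \<or> - S \<inter> X = {})"
    by (rule F_inner_closed) (use X in simp)
  then consider "X = {}" | "X = UNIV" | "X = S" | "X = - S" by blast
  then show False
  proof cases
    case 1
    then show False using X by (auto simp: cut_def)
  next
    case 2
    then have "\<delta> X = {}" by (auto simp: in_cut)
    then show False using X by simp
  next
    case 3
    then have "card (\<delta> S) = 2" using X gh by simp
    then show False using assms by simp
  next
    case 4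
    then have "card (\<delta> S) = 2" using X gh by (simp add: cut_Compl)
    then show False using assms by simp
  qed
qed

text \<open>As \<open>g\<close> lies outside \<open>G[S]\<close>, the cut \<open>{g, c}\<close>
  makes \<open>c\<close> a bridge of \<open>G[S]\<close>. Such a bridge is in series in
  \<open>G\<close> with a cut edge of \<open>U\<close>, that is \<open>g\<close> or
  \<open>h\<close>.\<close>

lemma class_of_g_inner:
  assumes c: "series U g c" "c \<in> E S"
  shows "series UNIV g c \<or> series UNIV h c"
proof -
  have "c \<noteq> g" using c E_disjoint g by blast
  then obtain X where X: "F \<inter> \<delta> X = {g, c}" using series_lift[OF c(1)] by blast
  have "g \<notin> E S" using E_disjoint g by blast
  then have "E S \<inter> \<delta> X = {c}"
    using cut_pairD[OF X subsetD[OF E_subset_F(1)]] c(2) by auto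
  then have "c \<in> bridges (E S)" unfolding bridges_def by blast
  then obtain g' where g': "g' \<in> \<delta> S" "series UNIV c g'" using bridge_series by blast
  have "c \<in> U" using series_subset(1)[OF bU subset_refl g_in_U c(1)] .
  then have "g' \<in> U" using series_subset(1)[OF bU _ _ g'(2)] by blast
  then have "g' = g \<or> g' = h" using g'(1) U_cut_S by blast
  then show ?thesis using series_sym[OF g'(2)] by blast
qed

text \<open>Restoring the deleted edges splits the class of \<open>g\<close> in \<open>U\<close>
  into the classes of \<open>g\<close> and \<open>h\<close> in \<open>G\<close>, which are different
  because the cut has a third edge.\<close>

lemma pair_classes_zero:
  assumes "card (\<delta> S) \<ge> 3"
  shows "sum w (cls UNIV g) + sum w (cls UNIV h) = 0"
proof -
  note bN = tec_bridges[OF tec_UNIV]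
  have "series UNIV g c \<or> series UNIV h c" if c: "series U g c" for c
  proof -
    consider "c \<in> E S" | "c \<in> E (- S)" | "c \<in> \<delta> S" using edge_cases by blast
    then show ?thesis
    proof cases
      case 1
      then show ?thesis using class_of_g_inner c by blast
    next
      case 2
      then show ?thesis
        using leg_pair.class_of_g_inner[OF pair_swap, unfolded cut_Compl, OF c] by blast
    next
      case 3
      have "c \<in> U" using series_subset(1)[OF bU subset_refl g_in_U c] .
      then have "c = g \<or> c = h" using 3 U_cut_S by blast
      then show ?thesis by auto
    qed
  qed
  moreover have "series U g c" if "series UNIV g c \<or> series UNIV h c" for c
    using that series_subset(2)[OF bU _ g_in_U] series_subset(2)[OF bU _ h_in_U]
      series_trans[OF bU series_g_h] by blast
  ultimately have "cls U g = cls UNIV g \<union> cls UNIV h" unfolding cls_def by blast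
  moreover have "cls UNIV g \<inter> cls UNIV h = {}"
    using not_series_UNIV[OF assms] series_trans[OF bN] series_sym unfolding cls_def by blast
  ultimately have "sum w (cls U g) = sum w (cls UNIV g) + sum w (cls UNIV h)"
    by (simp only: sum.union_disjoint finite)
  then show ?thesis using class_of_g_zero by simp
qed

end

context leg_graph
begin

lemma nonbridge_no_cut: "d \<in> E S - bridges (E S) \<Longrightarrow> E S \<inter> \<delta> X \<noteq> {d}"
  unfolding bridges_def by blast

lemma nonbridge_series:
  assumes d: "d \<in> E S - bridges (E S)" and X: "E S \<inter> \<delta> X = {d, c}"
  shows "c \<in> E S - bridges (E S)"
proof -
  have "c \<notin> bridges (E S)"
  proof
    assume "c \<in> bridges (E S)"
    then obtain Y where Y: "E S \<inter> \<delta> Y = {c}" unfolding bridges_def by blast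
    have "d \<noteq> c" using nonbridge_no_cut[OF d] Y by blast
    then have "E S \<inter> \<delta> (X - Y \<union> (Y - X)) = {d}" unfolding cut_sym_diff X Y by auto
    then show False using nonbridge_no_cut[OF d] by blast
  qed
  then show ?thesis using cut_pair_in[OF X] by blast
qed

text \<open>Two crossing sets whose cuts share the edge \<open>d\<close> would leave \<open>d\<close> as the only edge leaving
  their intersection.\<close>
lemma series_cuts_chain:
  assumes d: "d \<in> E S - bridges (E S)"
    and Y: "Y \<subseteq> S" "E S \<inter> \<delta> Y = {d, c}" "tgt d \<in> Y" "src d \<notin> Y"
    and Y': "Y' \<subseteq> S" "E S \<inter> \<delta> Y' = {d, c'}" "tgt d \<in> Y'" "src d \<notin> Y'"
  shows "Y \<subseteq> Y' \<or> Y' \<subseteq> Y"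
proof (rule ccontr)
  assume "\<not> ?thesis"
  then have ne: "Y - Y' \<noteq> {}" "Y' - Y \<noteq> {}" by blast+
  have cnb: "c \<in> E S - bridges (E S)" "c' \<in> E S - bridges (E S)"
    using nonbridge_series[OF d] Y(2) Y'(2) by blast+
  \<comment> \<open>The edge \<open>d\<close> runs from the intersection to outside the union, so
    only \<open>c\<close> and \<open>c'\<close> can leave a difference set. Neither can do so alone,
    as they are not bridges; so both leave both differences and hence not the intersection.\<close>
  have full: "c \<in> \<delta> Q \<and> c' \<in> \<delta> Q" if Q: "Q = Y - Y' \<or> Q = Y' - Y" for Q
  proof -
    have sub: "e \<in> E S \<Longrightarrow> e \<in> \<delta> Q \<Longrightarrow> e = c \<or> e = c'" for e
    proof -
      assume e: "e \<in> E S" "e \<in> \<delta> Q"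
      have "e \<noteq> d" using e(2) Q Y(3,4) Y'(3,4) by (auto simp: in_cut)
      moreover have "e \<in> \<delta> Y \<or> e \<in> \<delta> Y'" using e(2) Q cut_Diff_subset by blast
      ultimately show "e = c \<or> e = c'" using cut_pairD[OF Y(2) e(1)] cut_pairD[OF Y'(2) e(1)] by blast
    qed
    have "Q \<noteq> {}" "Q \<subseteq> S" "tgt d \<in> S - Q" using Q ne Y Y' by blast+
    then have "E S \<inter> \<delta> Q \<noteq> {}" using connected_in[of Q] by blast
    moreover have "E S \<inter> \<delta> Q \<noteq> {c}" "E S \<inter> \<delta> Q \<noteq> {c'}" using nonbridge_no_cut cnb by blast+
    ultimately show ?thesis using sub by blast
  qed
  have "c \<notin> \<delta> (Y \<inter> Y')" "c' \<notin> \<delta> (Y \<inter> Y')"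
    using full[of "Y - Y'"] full[of "Y' - Y"] by (auto simp: in_cut)
  moreover have "e \<in> E S \<Longrightarrow> e \<in> \<delta> (Y \<inter> Y') \<Longrightarrow> e = d \<or> e = c \<or> e = c'" for e
    using cut_Int_subset[of Y Y'] cut_pairD[OF Y(2)] cut_pairD[OF Y'(2)] by blast
  moreover have "d \<in> E S" "d \<in> \<delta> (Y \<inter> Y')" using d Y Y' by (auto simp: in_cut)
  ultimately have "E S \<inter> \<delta> (Y \<inter> Y') = {d}" by blast
  then show False using nonbridge_no_cut[OF d] by blast
qed

lemma series_side:
  assumes "E S \<inter> \<delta> X = {d, c}" "d \<in> E S"
  shows "\<exists>Y. Y \<subseteq> S \<and> E S \<inter> \<delta> Y = {d, c} \<and> tgt d \<in> Y \<and> src d \<notin> Y"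
proof -
  have ends: "src d \<in> S" "tgt d \<in> S" using assms(2) in_induced by auto
  have "d \<in> \<delta> X" by (rule cut_pair_in[OF assms(1)])
  then consider "tgt d \<in> X" "src d \<notin> X" | "tgt d \<notin> X" "src d \<in> X" by (auto simp: in_cut)
  then show ?thesis
  proof cases
    case 1
    have "S \<inter> X \<subseteq> S \<and> E S \<inter> \<delta> (S \<inter> X) = {d, c} \<and> tgt d \<in> S \<inter> X \<and> src d \<notin> S \<inter> X"
      unfolding cut_restrict using 1 ends assms(1) by simp
    then show ?thesis ..
  next
    case 2
    have "S - X \<subseteq> S \<and> E S \<inter> \<delta> (S - X) = {d, c} \<and> tgt d \<in> S - X \<and> src d \<notin> S - X"
      unfolding cut_restrict using 2 ends assms(1) by simp
    then show ?thesis ..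
  qed
qed

lemma cut_S_outer: "X \<subseteq> S \<Longrightarrow> x \<in> \<delta> S \<Longrightarrow> x \<in> \<delta> (S - X) \<longleftrightarrow> x \<notin> \<delta> X"
  by (auto simp: in_cut)

lemma cut_S_mono: "X \<subseteq> Y \<Longrightarrow> Y \<subseteq> S \<Longrightarrow> x \<in> \<delta> S \<Longrightarrow> x \<in> \<delta> X \<Longrightarrow> x \<in> \<delta> Y"
  by (auto simp: in_cut)

text \<open>The attachment sets \<open>T x\<close> of the edges \<open>x\<close> of the cut form a chain. For the pair \<open>g\<close>, \<open>h\<close>
  of its extremes, an edge is in series with \<open>d\<close> in \<open>U\<close> only if it is so in the whole graph.\<close>

lemma core_class_zero:
  assumes d: "d \<in> K" and card: "card (\<delta> S) \<ge> 2"
  shows "sum w (cls UNIV d) = 0"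
proof -
  have dE: "d \<in> E S - bridges (E S)" using d in_K by blast
  define C where "C = {c. \<exists>X. E S \<inter> \<delta> X = {d, c}}"
  \<comment> \<open>Every cut set is normalized to the side containing \<open>tgt d\<close>, which
    makes the sets comparable by \<open>series_cuts_chain\<close>.\<close>
  have "\<forall>c\<in>C. \<exists>Y. Y \<subseteq> S \<and> E S \<inter> \<delta> Y = {d, c} \<and> tgt d \<in> Y \<and> src d \<notin> Y"
    using series_side dE unfolding C_def by blast
  then obtain B where "\<forall>c\<in>C. B c \<subseteq> S \<and> E S \<inter> \<delta> (B c) = {d, c} \<and> tgt d \<in> B c \<and> src d \<notin> B c"
    by (rule bchoice[THEN exE])
  then have B: "B c \<subseteq> S" "E S \<inter> \<delta> (B c) = {d, c}" "tgt d \<in> B c" "src d \<notin> B c" if "c \<in> C" for c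
    using that by simp_all
  define T where "T = (\<lambda>x. {c \<in> C. x \<in> \<delta> (B c)})"
  have "T x \<subseteq> T y \<or> T y \<subseteq> T x" if "x \<in> \<delta> S" "y \<in> \<delta> S" for x y
  proof (rule ccontr)
    assume "\<not> ?thesis"
    then obtain c c' where c: "c \<in> C" "x \<in> \<delta> (B c)" "y \<notin> \<delta> (B c)"
      and c': "c' \<in> C" "y \<in> \<delta> (B c')" "x \<notin> \<delta> (B c')" unfolding T_def by blast
    have "B c \<subseteq> B c' \<or> B c' \<subseteq> B c"
      by (rule series_cuts_chain[OF dE B[OF c(1)] B[OF c'(1)]])
    then show False using cut_S_mono B(1) c c' that by metis
  qed
  then obtain g h where gh: "g \<in> \<delta> S" "h \<in> \<delta> S" "g \<noteq> h"
    and T: "\<And>x. x \<in> \<delta> S \<Longrightarrow> T g \<subseteq> T x \<and> T x \<subseteq> T h"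
    using ex_extremal_pair[of "\<delta> S" T] card by auto
  interpret leg_pair ends S e1 e2 w g h by unfold_locales (use gh in auto)
  show ?thesis
  proof (rule UNIV_class_zero)
    show "d \<in> U" using d K_subset_U by blast
    fix c assume c: "series U d c"
    show "series UNIV d c"
    proof (cases "d = c")
      case False
      then obtain X where X: "X \<subseteq> S" "E S \<inter> \<delta> X = {d, c}" "g \<notin> \<delta> X" "h \<notin> \<delta> X"
        using inner_cut_lift[OF dE c] by metis
      then have cC: "c \<in> C" unfolding C_def by blast
      let ?Y = "B c"
      have "E S \<inter> \<delta> (X - ?Y \<union> (?Y - X)) = {}" unfolding cut_sym_diff X(2) B(2)[OF cC] by simp
      then have "S \<subseteq> X - ?Y \<union> (?Y - X) \<or> S \<inter> (X - ?Y \<union> (?Y - X)) = {}" by (rule connected_in)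
      then have "X = ?Y \<or> X = S - ?Y" using X(1) B(1)[OF cC] by blast
      then have "g \<in> \<delta> ?Y \<longleftrightarrow> h \<in> \<delta> ?Y"
        using X(3,4) cut_S_outer[OF B(1)[OF cC] g] cut_S_outer[OF B(1)[OF cC] h] by blast
      then have "c \<in> T g \<longleftrightarrow> c \<in> T h" unfolding T_def by blast
      \<comment> \<open>As \<open>T g\<close> is smallest and \<open>T h\<close> largest, agreement
        of the two on \<open>c\<close> forces all cut edges to agree: none or all are attached to
        \<open>?Y\<close>. One of \<open>?Y\<close>, \<open>S - ?Y\<close> is then free of cut
        edges, and its 2-edge cut is one of \<open>G\<close>.\<close>
      then have "\<forall>x\<in>\<delta> S. c \<in> T x \<longleftrightarrow> c \<in> T g" using T by blast
      then have "\<forall>x\<in>\<delta> S. x \<in> \<delta> ?Y \<longleftrightarrow> g \<in> \<delta> ?Y" unfolding T_def using cC by blast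
      then consider "\<delta> S \<inter> \<delta> ?Y = {}" | "\<forall>x\<in>\<delta> S. x \<in> \<delta> ?Y" by blast
      then show ?thesis
      proof cases
        case 1
        then have "UNIV \<inter> \<delta> ?Y = {d, c}" using cut_inner[OF B(1)[OF cC]] B(2)[OF cC] by simp
        then show ?thesis unfolding series_def by blast
      next
        case 2
        have "\<delta> S \<inter> \<delta> (S - ?Y) = {}" using 2 cut_S_outer[OF B(1)[OF cC]] by blast
        moreover have "E S \<inter> \<delta> (S - ?Y) = {d, c}" unfolding cut_restrict by (rule B(2)[OF cC])
        ultimately have "UNIV \<inter> \<delta> (S - ?Y) = {d, c}" using cut_inner[of "S - ?Y"] by simp
        then show ?thesis unfolding series_def by blast
      qed
    qed simp
  qed
qed

text \<open>A bridge \<open>b\<close> cuts \<open>d\<close> off from \<open>e1\<close>, and the leg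
  \<open>Y\<close> behind it carries a single cut edge. With this edge as \<open>g\<close> and any
  other as \<open>h\<close>, the edge \<open>d\<close> is in \<open>U\<close>, and a 2-edge cut at
  \<open>d\<close> fits inside the leg, where no other cut edge is attached.\<close>

lemma leg_class_zero:
  assumes d: "d \<in> E S - bridges (E S)" "d \<notin> K" and card: "card (\<delta> S) \<ge> 3"
  shows "sum w (cls UNIV d) = 0"
proof -
  note bN = tec_bridges[OF tec_UNIV]
  have "\<exists>b\<in>bridges (E S). \<forall>Y. E S \<inter> \<delta> Y = {b} \<longrightarrow> (src e1 \<in> Y) \<noteq> (src d \<in> Y)"
  proof (rule ccontr)
    assume "\<not> ?thesis"
    then have "\<forall>b\<in>bridges (E S). \<exists>Y. E S \<inter> \<delta> Y = {b} \<and> (src e1 \<in> Y \<longleftrightarrow> src d \<in> Y)" by simp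
    then have "d \<in> K"
    proof (rule in_coreI[OF d(1)])
      fix X assume "E S \<inter> \<delta> X = {}"
      then have "S \<subseteq> X \<or> S \<inter> X = {}" by (rule connected_in)
      then show "src e1 \<in> X \<longleftrightarrow> src d \<in> X" using ends_e1 d in_induced[of d S] by blast
    qed
    then show False using d by blast
  qed
  then obtain b where b: "b \<in> bridges (E S)"
    and sep: "\<And>Y. E S \<inter> \<delta> Y = {b} \<Longrightarrow> (src e1 \<in> Y) \<noteq> (src d \<in> Y)" by blast
  obtain Y g where Y: "Y \<subseteq> S" "src e1 \<notin> Y" "tgt e1 \<notin> Y" and g: "g \<in> \<delta> S" and dY: "\<delta> Y = {b, g}"
    using leg_in[OF b] by blast
  have bE: "b \<in> E S" using b bridges_subset by blast
  have gE: "g \<notin> E S" using g E_disjoint by blast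
  have EY: "E S \<inter> \<delta> Y = {b}" unfolding dY using bE gE by auto
  have "d \<notin> \<delta> Y" unfolding dY using d b gE by auto
  then have dinY: "src d \<in> Y" "tgt d \<in> Y" using sep[OF EY] Y(2) by (auto simp: in_cut)
  have Ycut: "x = g" if "x \<in> \<delta> S" "x \<in> \<delta> Y" for x
    using that bE E_disjoint unfolding dY by blast
  have "\<delta> S \<noteq> {g}" using card by auto
  then obtain h where h: "h \<in> \<delta> S" "h \<noteq> g" using g by blast
  interpret leg_pair ends S e1 e2 w g h by unfold_locales (use g h in auto)
  have "UNIV \<inter> \<delta> Y = {b, g}" using dY by simp
  then have sbg: "series UNIV b g" unfolding series_def by blast
  have dF: "d \<in> F - bridges F" using d F_bridge_E E_subset_F by blast
  have dU: "d \<in> U"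
  proof (rule in_coreI[OF dF])
    show "\<forall>b\<in>bridges F. \<exists>Y. F \<inter> \<delta> Y = {b} \<and> (src g \<in> Y \<longleftrightarrow> src d \<in> Y)"
    proof
      fix b' assume b': "b' \<in> bridges F"
      have "\<exists>Y'. F \<inter> \<delta> Y' = {b'} \<and> src g \<notin> Y' \<and> src d \<notin> Y'"
      proof (cases "b' \<in> E S")
        case True
        obtain Y' g' where Y': "Y' \<subseteq> S" "src e1 \<notin> Y'" "tgt e1 \<notin> Y'" "src g \<notin> Y'"
          "g' \<in> \<delta> S - {g, h}" and dY': "\<delta> Y' = {b', g'}" and FY': "F \<inter> \<delta> Y' = {b'}"
          using F_bridge_inner[OF b' True] by (elim exE conjE) (rule that; assumption)
        have "src d \<notin> Y'"
        proof
          \<comment> \<open>Two legs sharing a vertex would make \<open>{b, b'}\<close> the cut of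
            \<open>Y \<inter> Y'\<close>. Then \<open>g\<close> and \<open>g'\<close> are in series
            in \<open>G\<close>, impossible for a cut of three or more edges.\<close>
          assume "src d \<in> Y'"
          have "x = b \<or> x = b'" if x: "x \<in> \<delta> (Y \<inter> Y')" for x
          proof (rule ccontr)
            assume n: "\<not> (x = b \<or> x = b')"
            have "x \<in> \<delta> Y \<or> x \<in> \<delta> Y'" using x cut_Int_subset by blast
            then have "x = g \<or> x = g'" using n unfolding dY dY' by blast
            then have xS: "x \<in> \<delta> S" using g Y'(5) by blast
            have "x \<in> \<delta> Y" by (rule cut_S_mono[OF _ Y(1) xS x]) blast
            then have "x = g" using Ycut xS by blast
            moreover have "x \<in> \<delta> Y'" by (rule cut_S_mono[OF _ Y'(1) xS x]) blast
            ultimately show False using n Y'(5) unfolding dY' by blast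
          qed
          moreover have "UNIV \<inter> \<delta> (Y \<inter> Y') \<noteq> {}"
            using tec_not_separated[OF tec_UNIV, of "Y \<inter> Y'" d e2] \<open>src d \<in> Y'\<close> dinY Y(1) ends_e2 by blast
          moreover have "\<delta> (Y \<inter> Y') \<noteq> {b}" "\<delta> (Y \<inter> Y') \<noteq> {b'}" by (rule bridgeless_UNIV)+
          ultimately have "UNIV \<inter> \<delta> (Y \<inter> Y') = {b, b'}" by blast
          then have "series UNIV b b'" unfolding series_def by blast
          moreover have "UNIV \<inter> \<delta> Y' = {b', g'}" using dY' by simp
          then have "series UNIV b' g'" unfolding series_def by blast
          ultimately have "series UNIV g g'"
            using series_trans[OF bN] series_sym[OF sbg] by blast
          moreover have "leg_pair ends S e1 e2 w g g'"
            by unfold_locales (use g Y'(5) in auto)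
          ultimately show False using leg_pair.not_series_UNIV card by blast
        qed
        then show ?thesis using FY' Y'(4) by blast
      next
        case False
        then have "b' \<in> E (- S)" using F_bridge_cases[OF b'] by blast
        then obtain Y' where "Y' \<subseteq> - S" "src g \<notin> Y'" "F \<inter> \<delta> Y' = {b'}"
          using leg_pair.F_bridge_inner[OF pair_swap, unfolded cut_Compl, OF b'] by blast
        moreover have "src d \<in> S" using d in_induced by blast
        ultimately show ?thesis by blast
      qed
      then obtain Y' where Y': "F \<inter> \<delta> Y' = {b'} \<and> src g \<notin> Y' \<and> src d \<notin> Y'" ..
      then have "src g \<in> Y' \<longleftrightarrow> src d \<in> Y'" by simp
      with conjunct1[OF Y'] have "F \<inter> \<delta> Y' = {b'} \<and> (src g \<in> Y' \<longleftrightarrow> src d \<in> Y')" ..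
      then show "\<exists>Y'. F \<inter> \<delta> Y' = {b'} \<and> (src g \<in> Y' \<longleftrightarrow> src d \<in> Y')" ..
    qed
  qed (rule F_connected)
  show ?thesis
  proof (rule UNIV_class_zero[OF dU])
    fix c assume c: "series U d c"
    show "series UNIV d c"
    proof (cases "d = c")
      case False
      then obtain X where X: "X \<subseteq> S" "E S \<inter> \<delta> X = {d, c}" "g \<notin> \<delta> X" "h \<notin> \<delta> X"
        using inner_cut_lift[OF d(1) c] by metis
      have cnb: "c \<in> E S - bridges (E S)" by (rule nonbridge_series[OF d(1) X(2)])
      have "c \<notin> \<delta> Y" unfolding dY using cnb b gE by auto
      then have cY: "src c \<in> Y \<longleftrightarrow> tgt c \<in> Y" by (simp add: in_cut)
      have dX: "d \<in> \<delta> X" by (rule cut_pair_in[OF X(2)])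
      have EYD: "x = b" if "x \<in> E S" "x \<in> \<delta> Y" for x using that gE unfolding dY by blast
      have bd: "b \<noteq> d" using b d by blast
      \<comment> \<open>With \<open>c\<close> outside the leg, the cut of
        \<open>X \<inter> Y\<close> in \<open>G[S]\<close> is \<open>{d}\<close> or
        \<open>{d, b}\<close>; the symmetric difference with \<open>Y\<close> removes
        \<open>b\<close>, so \<open>d\<close> would be a bridge.\<close>
      have cin: "src c \<in> Y"
      proof (rule ccontr)
        assume "src c \<notin> Y"
        then have "c \<notin> \<delta> (X \<inter> Y)" using cY by (auto simp: in_cut)
        then have "x = d \<or> x = b" if "x \<in> E S" "x \<in> \<delta> (X \<inter> Y)" for x
          using that cut_Int_subset[of X Y] cut_pairD[OF X(2)] EYD by blast
        moreover have "d \<in> E S" "d \<in> \<delta> (X \<inter> Y)" using dX dinY d by (auto simp: in_cut)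
        ultimately consider "E S \<inter> \<delta> (X \<inter> Y) = {d}" | "E S \<inter> \<delta> (X \<inter> Y) = {d, b}" by blast
        then show False
        proof cases
          case 1
          then show False using nonbridge_no_cut[OF d(1)] by blast
        next
          case 2
          have "E S \<inter> \<delta> (X \<inter> Y - Y \<union> (Y - X \<inter> Y)) = {d}"
            unfolding cut_sym_diff 2 EY using bd by auto
          then show False using nonbridge_no_cut[OF d(1)] by blast
        qed
      qed
      \<comment> \<open>Otherwise \<open>X - Y\<close> is left in \<open>G[S]\<close> by
        \<open>b\<close> alone, like \<open>Y\<close>, so together they cover \<open>S\<close>. Then
        the end of \<open>h\<close> in \<open>S\<close> lies in \<open>X\<close> or
        \<open>Y\<close>, yet \<open>h\<close> leaves neither.\<close>
      have "X \<subseteq> Y"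
      proof (rule ccontr)
        assume n: "\<not> X \<subseteq> Y"
        have "c \<notin> \<delta> (X - Y)" "d \<notin> \<delta> (X - Y)" using cin cY dinY by (auto simp: in_cut)
        then have 1: "x = b" if "x \<in> E S" "x \<in> \<delta> (X - Y)" for x
          using that cut_Diff_subset[of X Y] cut_pairD[OF X(2)] EYD by blast
        have "src d \<in> S - (X - Y)" using dinY Y(1) by blast
        then have "E S \<inter> \<delta> (X - Y) \<noteq> {}" using connected_in[of "X - Y"] n X(1) by blast
        then have XY: "E S \<inter> \<delta> (X - Y) = {b}" using 1 by blast
        have "E S \<inter> \<delta> (X - Y - Y \<union> (Y - (X - Y))) = {}" unfolding cut_sym_diff XY EY by simp
        then have "S \<subseteq> X - Y - Y \<union> (Y - (X - Y)) \<or> S \<inter> (X - Y - Y \<union> (Y - (X - Y))) = {}"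
          by (rule connected_in)
        then have "S \<subseteq> X \<union> Y" using dinY Y(1) by blast
        moreover have "h \<notin> \<delta> Y" using Ycut[OF h] gh by blast
        ultimately show False using X(1,4) Y(1) ends_h by (auto simp: in_cut[of h])
      qed
      have "\<delta> S \<inter> \<delta> X = {}" using cut_S_mono[OF \<open>X \<subseteq> Y\<close> Y(1)] Ycut X(3) by blast
      then have "UNIV \<inter> \<delta> X = {d, c}" using cut_inner[OF X(1)] X(2) by simp
      then show ?thesis unfolding series_def by blast
    qed simp
  qed
qed

lemma cut_class_zero:
  assumes g: "g \<in> \<delta> S" and card: "card (\<delta> S) \<ge> 3"
  shows "sum w (cls UNIV g) = 0"
proof -
  have "card (\<delta> S - {g}) \<ge> 2" using g card by simp
  then obtain h k where hk: "h \<in> \<delta> S - {g}" "k \<in> \<delta> S - {g}" "h \<noteq> k"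
    by (metis card_le_Suc0_iff_eq finite not_less_eq_eq numeral_2_eq_2)
  have pair: "sum w (cls UNIV x) + sum w (cls UNIV y) = 0"
    if "x \<in> \<delta> S" "y \<in> \<delta> S" "x \<noteq> y" for x y
  proof -
    interpret leg_pair ends S e1 e2 w x y by unfold_locales (use that in auto)
    show ?thesis by (rule pair_classes_zero[OF card])
  qed
  \<comment> \<open>The three weights have pairwise sums 0, so each of them is 0.\<close>
  show ?thesis using pair[of g h] pair[of g k] pair[of h k] g hk by auto
qed

lemma inner_edge_class_zero:
  assumes d: "d \<in> E S" and card: "card (\<delta> S) \<ge> 3"
  shows "sum w (cls UNIV d) = 0"
proof -
  consider "d \<in> K" | "d \<in> bridges (E S)" | "d \<in> E S - bridges (E S)" "d \<notin> K" using d by blast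
  then show ?thesis
  proof cases
    case 1
    then show ?thesis using core_class_zero card by simp
  next
    case 2
    then obtain g where g: "g \<in> \<delta> S" "series UNIV d g" using bridge_series by blast
    then show ?thesis
      using cls_eq[OF tec_bridges[OF tec_UNIV] g(2)] cut_class_zero[OF g(1) card] by simp
  next
    case 3
    then show ?thesis using leg_class_zero card by blast
  qed
qed

lemma class_zero: "sum w (cls UNIV d) = 0"
proof -
  have "card (\<delta> S) \<ge> 2" using card_cut_S_ge2[OF tec_UNIV] by simp
  then consider "card (\<delta> S) = 2" | "card (\<delta> S) \<ge> 3" by linarith
  then show ?thesis
  proof cases
    case 1
    then obtain g h where S: "\<delta> S = {g, h}" "g \<noteq> h" by (auto simp: card_2_iff)
    interpret leg_pair ends S e1 e2 w g h by unfold_locales (use S in auto)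
    have F: "F = UNIV" unfolding S by simp
    have "UNIV \<subseteq> U" by (rule tec_subset_core[OF tec_UNIV _ _ g_in_U]) (use F in auto)
    then have "U = UNIV" by blast
    then show ?thesis using U_class_zero[of d] by simp
  next
    case 2
    interpret s: leg_graph ends "- S" e2 e1 w by (rule leg_swap)
    show ?thesis
      using edge_cases[of d] inner_edge_class_zero[OF _ 2] cut_class_zero[OF _ 2]
        s.inner_edge_class_zero[unfolded cut_Compl, OF _ 2] by blast
  qed
qed

lemma tec_zero:
  assumes "tec H"
  shows "sum w H = 0"
  by (rule sum_union_of_classes[OF tec_bridges[OF tec_UNIV] _ class_zero])
    (use cls_subset[OF tec_bridges[OF assms]] in blast)

end

section \<open>The criterion for both sides and both cases\<close>

context cut_graph
begin

lemma bridge_delta_Wf: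
  assumes "f \<in> bridges (E S)" "f \<noteq> e1"
  shows "\<exists>Y. Y \<subseteq> S \<and> E S \<inter> \<delta> Y = {f} \<and> src e1 \<notin> Y \<and> tgt e1 \<notin> Y \<and>
    delta_Wf ends S e1 e2 S f = \<delta> S \<inter> \<delta> Y"
  using bridge_side[OF assms] by (elim exE conjE) (intro exI conjI delta_Wf_eq; assumption)

lemma tight_spans_delta_Wf:
  assumes "tight_spans" "f \<in> bridges (E S)" "e1 \<notin> bridges (E S)"
  shows "card (delta_Wf ends S e1 e2 S f) = 1"
proof -
  have "f \<noteq> e1" using assms by blast
  from bridge_delta_Wf[OF assms(2) this] obtain Y where
    Y: "Y \<subseteq> S" "E S \<inter> \<delta> Y = {f}" "src e1 \<notin> Y" "tgt e1 \<notin> Y"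
    and eq: "delta_Wf ends S e1 e2 S f = \<delta> S \<inter> \<delta> Y"
    by (elim exE conjE) (rule that; assumption)
  show ?thesis
    unfolding eq by (rule tight_spans_bridge[OF assms(1) Y(1,2)]) (use Y(3,4) in blast)
qed

lemma single_edge_leg:
  assumes "f \<in> bridges (E S)" "e1 \<notin> bridges (E S)" "card (delta_Wf ends S e1 e2 S f) = 1"
  shows "\<exists>Y g. Y \<subseteq> S \<and> src e1 \<notin> Y \<and> tgt e1 \<notin> Y \<and> g \<in> \<delta> S \<and> \<delta> Y = {f, g}"
proof -
  have "f \<noteq> e1" using assms by blast
  from bridge_delta_Wf[OF assms(1) this] obtain Y where
    Y: "Y \<subseteq> S" "E S \<inter> \<delta> Y = {f}" "src e1 \<notin> Y" "tgt e1 \<notin> Y"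
    and eq: "delta_Wf ends S e1 e2 S f = \<delta> S \<inter> \<delta> Y"
    by (elim exE conjE) (rule that; assumption)
  obtain g where g: "\<delta> S \<inter> \<delta> Y = {g}" using assms(3) unfolding eq by (meson card_1_singletonE)
  have "\<delta> Y = {f} \<union> {g}" using cut_inner[OF Y(1)] unfolding Y(2) g .
  then have "\<delta> Y = {f, g}" by (simp add: insert_commute)
  moreover have "g \<in> \<delta> S" using g by blast
  ultimately show ?thesis using Y by blast
qed

lemma tight_spans_iff:
  "tight_spans \<longleftrightarrow>
    ((e1 \<in> bridges (E S) \<or> e2 \<in> bridges (E (- S))) \<and> card (\<delta> S) = 2) \<or>
    (e1 \<notin> bridges (E S) \<and> e2 \<notin> bridges (E (- S)) \<and>
      (\<forall>W\<in>{S, - S}. \<forall>f. f \<in> bridges (E W) \<longrightarrow> card (delta_Wf ends S e1 e2 W f) = 1))"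
    (is "_ \<longleftrightarrow> ?one \<or> ?two")
proof -
  interpret s: cut_graph ends "- S" e2 e1 by (rule swap)
  note dW = delta_Wf_swap[of "- S"]
  show ?thesis
  proof
    assume t: tight_spans
    then have t': "s.tight_spans" by (simp add: tight_spans_swap)
    show "?one \<or> ?two"
    proof (cases "e1 \<in> bridges (E S) \<or> e2 \<in> bridges (E (- S))")
      case True
      then have "card (\<delta> S) = 2"
        using tight_spans_e1_bridge[OF t] s.tight_spans_e1_bridge[OF t'] by (auto simp: cut_Compl)
      then show ?thesis using True by blast
    next
      case False
      then have "card (delta_Wf ends S e1 e2 S f) = 1" if "f \<in> bridges (E S)" for f
        using tight_spans_delta_Wf[OF t that] by blast
      moreover have "card (delta_Wf ends S e1 e2 (- S) f) = 1" if "f \<in> bridges (E (- S))" for f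
        unfolding dW using s.tight_spans_delta_Wf[OF t' that] False by blast
      ultimately show ?thesis using False by blast
    qed
  next
    assume "?one \<or> ?two"
    then show tight_spans
    proof
      assume ?one
      then show tight_spans
        using e1_bridge_tight_spans s.e1_bridge_tight_spans by (auto simp: cut_Compl tight_spans_swap)
    next
      assume two: ?two
      then have nb: "e1 \<notin> bridges (E S)" "e2 \<notin> bridges (E (- S))" by blast+
      have leg: "\<exists>Y g. Y \<subseteq> S \<and> src e1 \<notin> Y \<and> tgt e1 \<notin> Y \<and> g \<in> \<delta> S \<and> \<delta> Y = {f, g}"
        if f: "f \<in> bridges (E S)" for f
        by (rule single_edge_leg[OF f nb(1)]) (use two f in blast)
      have leg': "\<exists>Y g. Y \<subseteq> - S \<and> src e2 \<notin> Y \<and> tgt e2 \<notin> Y \<and> g \<in> \<delta> S \<and> \<delta> Y = {f, g}"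
        if f: "f \<in> bridges (E (- S))" for f
      proof -
        have "card (delta_Wf ends S e1 e2 (- S) f) = 1" using two f by blast
        then show ?thesis using s.single_edge_leg[OF f nb(2)] unfolding dW cut_Compl by simp
      qed
      show tight_spans
        unfolding tight_spans_def
      proof (intro allI impI)
        fix w :: "'e \<Rightarrow> real" and H
        assume w: "\<forall>H. tec H \<longrightarrow> tight H \<longrightarrow> sum w H = 0" and H: "tec H"
        interpret leg_graph ends S e1 e2 w
          by unfold_locales (use nb w in blast, use nb in blast, rule leg, assumption,
            rule leg', assumption, use w in blast)
        show "sum w H = 0" by (rule tec_zero[OF H])
      qed
    qed
  qed
qed

end

theorem mainTheorem8:
  fixes ends :: "'e::finite \<Rightarrow> 'v::finite set"
    and S :: "'v set" and e1 e2 :: 'e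
  assumes simple: "inj ends" "\<forall>e. card (ends e) = 2"
    and tec: "two_edge_connected ends UNIV UNIV"
    and S: "{} \<noteq> S" "S \<noteq> UNIV" and mincut: "min_cut ends S"
    and e1: "e1 \<in> induced_edges ends S"
    and e2: "e2 \<in> induced_edges ends (- S)"
  shows "defines_facet (\<lambda>x. 2 * x $ e1 - xsum x (cut ends S) + 2 * x $ e2) 2 (TECSP ends)
     \<longleftrightarrow>
     (((is_bridge ends S (induced_edges ends S) e1 \<or> is_bridge ends (- S) (induced_edges ends (- S)) e2)
         \<and> card (cut ends S) = 2)
      \<or> (\<not> is_bridge ends S (induced_edges ends S) e1 \<and> \<not> is_bridge ends (- S) (induced_edges ends (- S)) e2
         \<and> (\<forall>W \<in> {S, - S}. \<forall>f. is_bridge ends W (induced_edges ends W) f \<longrightarrow>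
               card (delta_Wf ends S e1 e2 W f) = 1)))"
proof -
  interpret multigraph ends by unfold_locales (use simple in blast)
  have mincut': "min_cut ends (- S)"
    using mincut S unfolding min_cut_def cut_Compl by auto
  interpret cut_graph ends S e1 e2
  proof unfold_locales
    show "tec UNIV"
      by (rule two_edge_connected_tec[OF _ tec]) (simp add: is_subgraph_def)
  qed (use min_cut_connected[OF tec mincut] min_cut_connected[OF tec mincut'] e1 e2 in blast)+
  show ?thesis
    unfolding defines_facet_iff tight_spans_iff is_bridge_induced ..
qed

end
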